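(* Let $m\ge 3$ be odd, $q=2^m$, $N=2q=2^{m+1}$. Let $K\subseteq \mathbb{Z}_4^q$ be a $\mathbb{Z}_4$-linear Kerdock code and $P=K^{\perp}$ the corresponding $\mathbb{Z}_4$-linear Preparata code (see context). Fix a coordinate position $i$. Let $K_{\rm short}\subseteq \mathbb{Z}_4^{q-1}$ be the code obtained from $K$ by shortening at $i$, let $C=P_{\rm punct}\subseteq \mathbb{Z}_4^{q-1}$ be the code obtained from $P$ by puncturing at $i$, and let $A=\mathbb{Z}_4^{q-1}$ (so $K_{\rm short}^{\perp}=C$ and $|K_{\rm short}|=|A/C|=4^m$). (i) Define relations on $K_{\rm short}$ by: $(x,y)\in R_0$ if $x-y$ has Lee weight $0$; $(x,y)\in R_1$ if $x-y$ has Lee weight $2^m+2^{(m-1)/2}$; $(x,y)\in R_2$ if $x-y$ has Lee weight $2^m-2^{(m-1)/2}$; $(x,y)\in R_3$ if $x-y$ has Lee weight $2^m$. Then $(K_{\rm short},\{R_0,R_1,R_2,R_3\})$ is a three-class (abelian) association scheme with first and second eigenmatrices $$P=\begin{pmatrix} 1 & \frac{(N-2\sqrt{N})(N-2)}{8} & \frac{(N+2\sqrt{N})(N-2)}{8} & \frac{N}{2}-1 \\ 1 & -\frac{\sqrt{N}(N-4)}{8} & \frac{\sqrt{N}(N-4)}{8} & -1 \\ 1 & \frac{\sqrt{N}}{2} & -\frac{\sqrt{N}}{2} & -1 \\ 1 & -\frac{N-2\sqrt{N}}{4} & -\frac{N+2\sqrt{N}}{4} & \frac{N}{2}-1 \end{pmatrix},\qquad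 Q=\begin{pmatrix} 1 & N-2 & \frac{(N-2)(N-4)}{4} & \frac{N}{2}-1 \\ 1 & -\sqrt{N}-2 & \sqrt{N}+2 & -1 \\ 1 & \sqrt{N}-2 & -\sqrt{N}+2 & -1 \\ 1 & -2 & -\frac{N}{2}+2 & \frac{N}{2}-1 \end{pmatrix}.$$ (ii) Let $e_j$ denote the $j$-th standard unit vector of $A$. Define relations on the set $A/C$ of cosets by: $(x,y)\in R'_0$ if $x-y= C$; $(x,y)\in R'_1$ if $x-y=\pm e_j+C$ for some $j$; $(x,y)\in R'_2$ if $x-y=e_j-e_k+C$ for some $j\neq k$; $(x,y)\in R'_3$ if $x-y=2e_j+C$ for some $j$. Then $(A/C,\{R'_0,\dots,R'_3\})$ is a three-class association scheme which is the dual of the scheme in (i) (with respect to the nondegenerate pairing $K_{\rm short}\times A/C\to\mathbb{Z}_4$, $(x,y+C)\mapsto x\cdot y$, identifying $A/C$ with the character group of $K_{\rm short}$), and its first and second eigenmatrices are $P'=Q$ and $Q'=P$.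
   Context: $\mathbb{Z}_4$-valued quadratic forms: let $V=\mathbb{F}_2^m$; for a binary symmetric $m\times m$ matrix $R$ (entries identified with $0,1\in\mathbb{Z}_4$) define $T_R:V\to\mathbb{Z}_4$ by $T_R(v)=\sum_i R_{ii}\hat v_i^2+2\sum_{i<j}R_{ij}\hat v_i\hat v_j$, where $\hat v\in\mathbb{Z}_4^m$ reduces to $v$ mod 2. A $\mathbb{Z}_4$-Kerdock code of length $q=2^m$ (coordinates indexed by $V$) is a code $\{(T_R(v)+2\hat s\cdot\hat v+\varepsilon)_{v\in V}: R\in S,\ s\in V,\ \varepsilon\in\mathbb{Z}_4\}$, where $S$ is a set of $2^m$ binary symmetric $m\times m$ matrices whose pairwise differences are nonsingular; it is called $\mathbb{Z}_4$-linear if it is an additive subgroup of $\mathbb{Z}_4^q$ (e.g. the Hammons–Kumar–Calderbank–Sloane–Solé quaternary Kerdock code built from the Galois ring $GR(4,m)$). The Preparata code is $P=K^\perp$ with respect to the standard dot product over $\mathbb{Z}_4$. Lee weight on $\mathbb{Z}_4$: $wt(0)=0$, $wt(\pm1)=1$, $wt(2)=2$, extended additively to vectors. Puncturing at $i$ deletes coordinate $i$ from all codewords; shortening at $i$ takes the codewords with $0$ at $i$ and deletes that coordinate. Eigenmatrix conventions: for a scheme with adjacency matrices $A_j$ and primitive idempotents $E_i$, $A_j=\sum_i P_{ij}E_i$ and $E_j=\frac{1}{|X|}\sum_i Q_{ij}A_i$. *)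

theory Defs
  imports
    "HOL-Library.Z2"
    "HOL-Library.Numeral_Type"
    "HOL-Analysis.Cartesian_Space"
    "HOL-Algebra.Product_Groups"
begin

section \<open>Words and codes over $Z_4$\<close>

text \<open>
  The ring $Z_4$ is the numeral type \<^typ>\<open>4\<close>, the field $F_2$ is \<^typ>\<open>bit\<close>.  A word with
  coordinate set \<open>I\<close> is an extensional function on \<open>I\<close>, so that deleting a coordinate is
  \<^const>\<open>restrict\<close>.
\<close>

definition Z4 :: "4 monoid"
  where "Z4 = \<lparr>carrier = UNIV, monoid.mult = (+), one = 0\<rparr>"

definition word_group :: "'v set \<Rightarrow> ('v \<Rightarrow> 4) monoid"
  where "word_group I = product_group I (\<lambda>_. Z4)"

definition dot_product :: "'v set \<Rightarrow> ('v \<Rightarrow> 4) \<Rightarrow> ('v \<Rightarrow> 4) \<Rightarrow> 4"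
  where "dot_product I x y = (\<Sum>j\<in>I. x j * y j)"

definition lee_weight1 :: "4 \<Rightarrow> nat"
  where "lee_weight1 a = (if a = 0 then 0 else if a = 2 then 2 else 1)"

definition lee_weight :: "'v set \<Rightarrow> ('v \<Rightarrow> 4) \<Rightarrow> nat"
  where "lee_weight I x = (\<Sum>j\<in>I. lee_weight1 (x j))"

definition unit_word :: "'v set \<Rightarrow> 'v \<Rightarrow> 'v \<Rightarrow> 4"
  where "unit_word I j = (\<lambda>k\<in>I. if k = j then 1 else 0)"

definition dual_code :: "'v set \<Rightarrow> ('v \<Rightarrow> 4) set \<Rightarrow> ('v \<Rightarrow> 4) set"
  where "dual_code I K = {y \<in> carrier (word_group I). \<forall>x\<in>K. dot_product I x y = 0}"

definition puncture :: "'v set \<Rightarrow> 'v \<Rightarrow> ('v \<Rightarrow> 4) set \<Rightarrow> ('v \<Rightarrow> 4) set"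
  where "puncture I i K = (\<lambda>x. restrict x (I - {i})) ` K"

definition shorten :: "'v set \<Rightarrow> 'v \<Rightarrow> ('v \<Rightarrow> 4) set \<Rightarrow> ('v \<Rightarrow> 4) set"
  where "shorten I i K = (\<lambda>x. restrict x (I - {i})) ` {x \<in> K. x i = 0}"


section \<open>Kerdock codes\<close>

type_synonym 'm bvec = "(bit, 'm) vec"

text \<open>
  The forms below do not depend on the chosen lift of a vector from $F_2$ to $Z_4$; the lift with
  entries 0, 1 is used.
\<close>

definition lift4 :: "bit \<Rightarrow> 4"
  where "lift4 b = (if b = 0 then 0 else 1)"

definition quad_form ::
    "bit^'m::{finite,linorder}^'m::{finite,linorder} \<Rightarrow> 'm bvec \<Rightarrow> 4"
  where "quad_form R v =
    (\<Sum>i\<in>UNIV. lift4 (R $ i $ i) * (lift4 (v $ i))\<^sup>2) +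
    2 * (\<Sum>i\<in>UNIV. \<Sum>j | i < j. lift4 (R $ i $ j) * lift4 (v $ i) * lift4 (v $ j))"

definition kerdock_set :: "(bit^'m^'m) set \<Rightarrow> bool"
  where "kerdock_set S \<longleftrightarrow>
    card S = 2 ^ CARD('m) \<and>
    (\<forall>R\<in>S. Finite_Cartesian_Product.transpose R = R) \<and>
    (\<forall>R\<in>S. \<forall>R'\<in>S. R \<noteq> R' \<longrightarrow> invertible (R - R'))"

definition kerdock_words ::
    "(bit^'m::{finite,linorder}^'m::{finite,linorder}) set \<Rightarrow> ('m bvec \<Rightarrow> 4) set"
  where "kerdock_words S =
    {(\<lambda>v. quad_form R v + 2 * (\<Sum>i\<in>UNIV. lift4 (s $ i) * lift4 (v $ i)) + \<epsilon>) | R s \<epsilon>. R \<in> S}"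

definition kerdock_code :: "('m::{finite,linorder} bvec \<Rightarrow> 4) set \<Rightarrow> bool"
  where "kerdock_code K \<longleftrightarrow> (\<exists>S. kerdock_set S \<and> K = kerdock_words S)"


section \<open>Association schemes\<close>

definition association_scheme :: "'a set \<Rightarrow> nat \<Rightarrow> (nat \<Rightarrow> ('a \<times> 'a) set) \<Rightarrow> bool"
  where "association_scheme X d R \<longleftrightarrow>
    finite X \<and> X \<noteq> {} \<and>
    R 0 = Id_on X \<and>
    (\<Union>i\<le>d. R i) = X \<times> X \<and>
    (\<forall>i\<le>d. R i \<noteq> {}) \<and>
    (\<forall>i\<le>d. \<forall>j\<le>d. i \<noteq> j \<longrightarrow> R i \<inter> R j = {}) \<and>
    (\<forall>i\<le>d. sym (R i)) \<and>
    (\<forall>i\<le>d. \<forall>j\<le>d. \<forall>k\<le>d. \<exists>p. \<forall>(x, y)\<in>R k. card {z \<in> X. (x, z) \<in> R i \<and> (z, y) \<in> R j} = p)"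

definition abelian_scheme ::
    "('a, 'b) monoid_scheme \<Rightarrow> nat \<Rightarrow> (nat \<Rightarrow> ('a \<times> 'a) set) \<Rightarrow> bool"
  where "abelian_scheme G d R \<longleftrightarrow>
    comm_group G \<and> association_scheme (carrier G) d R \<and>
    (\<forall>i\<le>d. \<forall>(x, y)\<in>R i. \<forall>z\<in>carrier G. (x \<otimes>\<^bsub>G\<^esub> z, y \<otimes>\<^bsub>G\<^esub> z) \<in> R i)"

definition diff_rel :: "('a, 'b) monoid_scheme \<Rightarrow> 'a set \<Rightarrow> ('a \<times> 'a) set"
  where "diff_rel G D =
    {(x, y). x \<in> carrier G \<and> y \<in> carrier G \<and> x \<otimes>\<^bsub>G\<^esub> inv\<^bsub>G\<^esub> y \<in> D}"

text \<open>
  Matrices indexed by \<open>X\<close> are functions of two arguments that vanish outside \<open>X \<times> X\<close>.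
\<close>

type_synonym 'a cmatrix = "'a \<Rightarrow> 'a \<Rightarrow> complex"

definition adjacency :: "('a \<times> 'a) set \<Rightarrow> 'a cmatrix"
  where "adjacency r = (\<lambda>x y. of_bool ((x, y) \<in> r))"

definition cmat_mult :: "'a set \<Rightarrow> 'a cmatrix \<Rightarrow> 'a cmatrix \<Rightarrow> 'a cmatrix"
  where "cmat_mult X M M' = (\<lambda>x y. \<Sum>z\<in>X. M x z * M' z y)"

definition bose_mesner :: "nat \<Rightarrow> (nat \<Rightarrow> ('a \<times> 'a) set) \<Rightarrow> 'a cmatrix set"
  where "bose_mesner d R = {(\<lambda>x y. \<Sum>i\<le>d. c i * adjacency (R i) x y) | c. True}"

definition primitive_idempotent ::
    "'a set \<Rightarrow> nat \<Rightarrow> (nat \<Rightarrow> ('a \<times> 'a) set) \<Rightarrow> 'a cmatrix \<Rightarrow> bool"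
  where "primitive_idempotent X d R e \<longleftrightarrow>
    e \<in> bose_mesner d R \<and> e \<noteq> (\<lambda>x y. 0) \<and> cmat_mult X e e = e \<and>
    (\<forall>f\<in>bose_mesner d R. cmat_mult X f f = f \<and> cmat_mult X e f = f \<longrightarrow> f = (\<lambda>x y. 0) \<or> f = e)"

definition idempotent_ordering ::
    "'a set \<Rightarrow> nat \<Rightarrow> (nat \<Rightarrow> ('a \<times> 'a) set) \<Rightarrow> (nat \<Rightarrow> 'a cmatrix) \<Rightarrow> bool"
  where "idempotent_ordering X d R E \<longleftrightarrow>
    bij_betw E {..d} {e. primitive_idempotent X d R e} \<and>
    E 0 = (\<lambda>x y. of_bool (x \<in> X \<and> y \<in> X) / of_nat (card X))"

definition first_eigenmatrix ::
    "nat \<Rightarrow> (nat \<Rightarrow> ('a \<times> 'a) set) \<Rightarrow> (nat \<Rightarrow> 'a cmatrix) \<Rightarrow> (nat \<Rightarrow> nat \<Rightarrow> real) \<Rightarrow> bool"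
  where "first_eigenmatrix d R E P \<longleftrightarrow>
    (\<forall>j\<le>d. adjacency (R j) = (\<lambda>x y. \<Sum>i\<le>d. of_real (P i j) * E i x y))"

definition second_eigenmatrix ::
    "'a set \<Rightarrow> nat \<Rightarrow> (nat \<Rightarrow> ('a \<times> 'a) set) \<Rightarrow> (nat \<Rightarrow> 'a cmatrix) \<Rightarrow> (nat \<Rightarrow> nat \<Rightarrow> real) \<Rightarrow> bool"
  where "second_eigenmatrix X d R E Q \<longleftrightarrow>
    (\<forall>j\<le>d. E j =
      (\<lambda>x y. 1 / of_nat (card X) * (\<Sum>i\<le>d. of_real (Q i j) * adjacency (R i) x y)))"


section \<open>Characters and dual schemes\<close>

definition character_group :: "('a, 'b) monoid_scheme \<Rightarrow> ('a \<Rightarrow> complex) monoid"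
  where "character_group G =
    \<lparr>carrier = {\<phi> \<in> extensional (carrier G). \<phi> \<one>\<^bsub>G\<^esub> = 1 \<and>
        (\<forall>x\<in>carrier G. \<forall>y\<in>carrier G. \<phi> (x \<otimes>\<^bsub>G\<^esub> y) = \<phi> x * \<phi> y)},
     monoid.mult = (\<lambda>\<phi> \<psi>. \<lambda>x\<in>carrier G. \<phi> x * \<psi> x),
     one = (\<lambda>x\<in>carrier G. 1)\<rparr>"

text \<open>
  Each character is a common eigenvector of the adjacency matrices of an abelian scheme, hence lies
  in the column space of exactly one primitive idempotent.  The \<open>j\<close>-th class of the dual scheme joins two characters whose
  quotient lies in the column space of \<open>E j\<close>.
\<close>

definition dual_relation ::
    "('a, 'b) monoid_scheme \<Rightarrow> (nat \<Rightarrow> 'a cmatrix) \<Rightarrow> nat \<Rightarrow> (('a \<Rightarrow> complex) \<times> ('a \<Rightarrow> complex)) set"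
  where "dual_relation G E j = diff_rel (character_group G)
    {\<phi> \<in> carrier (character_group G).
       \<forall>x\<in>carrier G. (\<Sum>z\<in>carrier G. E j x z * \<phi> z) = \<phi> x}"

definition nondegenerate_pairing ::
    "('a, 'c) monoid_scheme \<Rightarrow> ('b, 'd) monoid_scheme \<Rightarrow> ('a \<Rightarrow> 'b \<Rightarrow> 4) \<Rightarrow> bool"
  where "nondegenerate_pairing G H \<beta> \<longleftrightarrow>
    (\<forall>x\<in>carrier G. \<beta> x \<in> hom H Z4) \<and>
    (\<forall>y\<in>carrier H. (\<lambda>x. \<beta> x y) \<in> hom G Z4) \<and>
    (\<forall>x\<in>carrier G. (\<forall>y\<in>carrier H. \<beta> x y = 0) \<longrightarrow> x = \<one>\<^bsub>G\<^esub>) \<and>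
    (\<forall>y\<in>carrier H. (\<forall>x\<in>carrier G. \<beta> x y = 0) \<longrightarrow> y = \<one>\<^bsub>H\<^esub>)"

text \<open>The embedding $a \mapsto i^a$ of $Z_4$ into the multiplicative group of complex numbers.\<close>

definition i_power :: "4 \<Rightarrow> complex"
  where "i_power a = (if a = 0 then 1 else if a = 1 then \<i> else if a = 2 then -1 else -\<i>)"

definition pairing_character ::
    "('a, 'b) monoid_scheme \<Rightarrow> ('a \<Rightarrow> 'h \<Rightarrow> 4) \<Rightarrow> 'h \<Rightarrow> 'a \<Rightarrow> complex"
  where "pairing_character G \<beta> y = (\<lambda>x\<in>carrier G. i_power (\<beta> x y))"

definition dual_scheme_via ::
    "('a, 'c) monoid_scheme \<Rightarrow> (nat \<Rightarrow> 'a cmatrix) \<Rightarrow> ('b, 'd) monoid_scheme \<Rightarrow>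
     nat \<Rightarrow> (nat \<Rightarrow> ('b \<times> 'b) set) \<Rightarrow> ('a \<Rightarrow> 'b \<Rightarrow> 4) \<Rightarrow> bool"
  where "dual_scheme_via G E H d R' \<beta> \<longleftrightarrow>
    nondegenerate_pairing G H \<beta> \<and>
    pairing_character G \<beta> \<in> iso H (character_group G) \<and>
    (\<forall>j\<le>d. \<forall>y\<in>carrier H. \<forall>y'\<in>carrier H.
       (y, y') \<in> R' j \<longleftrightarrow>
       (pairing_character G \<beta> y, pairing_character G \<beta> y') \<in> dual_relation G E j)"

text \<open>
  The value $x \cdot y$ for any \<open>y\<close> in the coset \<open>Y\<close>; meaningful if it does not depend on \<open>y\<close>.
\<close>

definition coset_pairing :: "'v set \<Rightarrow> ('v \<Rightarrow> 4) \<Rightarrow> ('v \<Rightarrow> 4) set \<Rightarrow> 4"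
  where "coset_pairing I x Y = the_elem (dot_product I x ` Y)"


section \<open>The eigenmatrices\<close>

definition P_matrix :: "real \<Rightarrow> nat \<Rightarrow> nat \<Rightarrow> real"
  where "P_matrix N i j =
    [[1, (N - 2 * sqrt N) * (N - 2) / 8, (N + 2 * sqrt N) * (N - 2) / 8, N / 2 - 1],
     [1, - (sqrt N * (N - 4) / 8),       sqrt N * (N - 4) / 8,           -1],
     [1, sqrt N / 2,                     - (sqrt N / 2),                 -1],
     [1, - ((N - 2 * sqrt N) / 4),       - ((N + 2 * sqrt N) / 4),       N / 2 - 1]] ! i ! j"

definition Q_matrix :: "real \<Rightarrow> nat \<Rightarrow> nat \<Rightarrow> real"
  where "Q_matrix N i j =
    [[1, N - 2,        (N - 2) * (N - 4) / 4, N / 2 - 1],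
     [1, - sqrt N - 2, sqrt N + 2,            -1],
     [1, sqrt N - 2,   - sqrt N + 2,          -1],
     [1, -2,           - (N / 2) + 2,         N / 2 - 1]] ! i ! j"

end

theory Submission
  imports Defs
begin

text \<open>
  For dual partitions of two finite abelian groups \<open>G\<close>, \<open>H\<close> with a nondegenerate bicharacter, the
  sums of the characters in a class of \<open>H\<close> give the primitive idempotents of a scheme on \<open>G\<close>, the
  character sums over the classes of \<open>H\<close> form its second eigenmatrix, and those over the classes of
  \<open>G\<close> its first.

  Here \<open>G\<close> is the shortened Kerdock code and \<open>H = A/C\<close>.  With the convention \<open>e i = 0\<close>, the
  cosets of \<open>e j - e k\<close> for \<open>j \<noteq> k\<close> and of \<open>2 e j\<close> are indexed by pairs of coordinates.  They are
  distinct because a Kerdock set maps bijectively onto $V$ under both \<open>R \<mapsto> R w\<close> (\<open>w \<noteq> 0\<close>) and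
  \<open>R \<mapsto> diag R\<close>, the latter since \<open>m\<close> is odd; by counting, they are all cosets.  The character sums
  over the classes of \<open>A/C\<close> at a codeword \<open>x\<close> depend only on $W = \sum_v i^{x_v}$ and
  $\sum_v (-1)^{x_v}$, and \<open>q - Re W\<close> is the Lee weight of \<open>x\<close>.  If \<open>x\<close> comes from a nonsingular
  form then $W$ is a Gaussian integer of norm $2^m$ with \<open>m\<close> odd, so its real part is one of
  $\pm 2^{(m-1)/2}$.
\<close>

section \<open>Orthogonal idempotents and eigenmatrices\<close>

locale orthogonal_idempotents =
  fixes X :: "'a set" and d :: nat and E :: "nat \<Rightarrow> 'a cmatrix"
  assumes E_mult_E: "\<And>i j. i \<le> d \<Longrightarrow> j \<le> d \<Longrightarrow>
      cmat_mult X (E i) (E j) = (if i = j then E i else (\<lambda>x y. 0))"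
    and E_nonzero: "\<And>i. i \<le> d \<Longrightarrow> E i \<noteq> (\<lambda>x y. 0)"
begin

definition lin_comb :: "(nat \<Rightarrow> complex) \<Rightarrow> 'a cmatrix"
  where "lin_comb c = (\<lambda>x y. \<Sum>i\<le>d. c i * E i x y)"

lemma lin_comb_cong: "(\<And>i. i \<le> d \<Longrightarrow> b i = c i) \<Longrightarrow> lin_comb b = lin_comb c"
  by (simp add: lin_comb_def)

lemma lin_comb_of_bool:
  assumes "k \<le> d"
  shows "lin_comb (\<lambda>i. c i * of_bool (i = k)) = (\<lambda>x y. c k * E k x y)"
proof (intro ext)
  fix x y
  have "lin_comb (\<lambda>i. c i * of_bool (i = k)) x y = (\<Sum>i\<le>d. if i = k then c k * E k x y else 0)"
    unfolding lin_comb_def by (intro sum.cong refl) simp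
  then show "lin_comb (\<lambda>i. c i * of_bool (i = k)) x y = c k * E k x y"
    using assms by simp
qed

lemma E_eq_lin_comb: "k \<le> d \<Longrightarrow> E k = lin_comb (\<lambda>i. of_bool (i = k))"
  using lin_comb_of_bool[of k "\<lambda>_. 1"] by simp

lemma lin_comb_mult: "cmat_mult X (lin_comb b) (lin_comb c) = lin_comb (\<lambda>i. b i * c i)"
proof (intro ext)
  fix x y
  have "cmat_mult X (lin_comb b) (lin_comb c) x y =
      (\<Sum>z\<in>X. \<Sum>i\<le>d. \<Sum>j\<le>d. b i * c j * (E i x z * E j z y))"
    by (simp add: cmat_mult_def lin_comb_def sum_product mult_ac)
  also have "\<dots> = (\<Sum>i\<le>d. \<Sum>j\<le>d. b i * c j * cmat_mult X (E i) (E j) x y)"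
    unfolding cmat_mult_def sum_distrib_left
    by (subst sum.swap) (intro sum.cong refl sum.swap)
  also have "\<dots> = (\<Sum>i\<le>d. \<Sum>j\<le>d. if j = i then b i * c i * E i x y else 0)"
    by (intro sum.cong refl) (auto simp: E_mult_E)
  finally show "cmat_mult X (lin_comb b) (lin_comb c) x y = lin_comb (\<lambda>i. b i * c i) x y"
    by (simp add: lin_comb_def)
qed

lemma lin_comb_eq_iff: "lin_comb b = lin_comb c \<longleftrightarrow> (\<forall>k\<le>d. b k = c k)"
proof
  assume eq: "lin_comb b = lin_comb c"
  have coefficient: "cmat_mult X (lin_comb a) (E k) = (\<lambda>x y. a k * E k x y)" if "k \<le> d" for a k
    by (subst E_eq_lin_comb[OF that]) (simp only: lin_comb_mult lin_comb_of_bool[OF that])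
  show "\<forall>k\<le>d. b k = c k"
  proof (intro allI impI)
    fix k assume k: "k \<le> d"
    then obtain x y where "E k x y \<noteq> 0" using E_nonzero by (meson ext)
    moreover have "b k * E k x y = c k * E k x y"
      using coefficient[OF k, of b] coefficient[OF k, of c] eq by metis
    ultimately show "b k = c k" by simp
  qed
qed (auto intro: lin_comb_cong)

lemma lin_comb_idempotent_iff:
  "cmat_mult X (lin_comb c) (lin_comb c) = lin_comb c \<longleftrightarrow> (\<forall>k\<le>d. c k = 0 \<or> c k = 1)"
  by (auto simp: lin_comb_mult lin_comb_eq_iff)

lemma E_in_range_lin_comb: "k \<le> d \<Longrightarrow> E k \<in> range lin_comb"
  using E_eq_lin_comb by blast

lemma lin_comb_0: "lin_comb (\<lambda>i. 0) = (\<lambda>x y. 0)"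
  by (simp add: lin_comb_def)

lemma primitive_idempotent_iff:
  assumes bose_mesner: "bose_mesner d R = range lin_comb"
  shows "primitive_idempotent X d R e \<longleftrightarrow> e \<in> E ` {..d}"
proof
  assume e: "primitive_idempotent X d R e"
  then obtain c where c: "e = lin_comb c" by (auto simp: primitive_idempotent_def bose_mesner)
  have "e \<noteq> lin_comb (\<lambda>i. 0)" using e by (simp add: primitive_idempotent_def lin_comb_0)
  then obtain k where k: "k \<le> d" "c k \<noteq> 0" by (auto simp: c lin_comb_eq_iff)
  moreover have "c k = 0 \<or> c k = 1"
    using e k(1) unfolding primitive_idempotent_def c lin_comb_idempotent_iff by blast
  ultimately have "cmat_mult X e (E k) = E k"
    unfolding c E_eq_lin_comb[OF k(1)] lin_comb_mult by (intro lin_comb_cong) auto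
  moreover have "cmat_mult X (E k) (E k) = E k"
    using k(1) by (simp add: E_mult_E)
  ultimately have "E k = (\<lambda>x y. 0) \<or> E k = e"
    using e E_in_range_lin_comb[OF k(1)] unfolding primitive_idempotent_def bose_mesner by blast
  with k(1) E_nonzero show "e \<in> E ` {..d}" by blast
next
  assume "e \<in> E ` {..d}"
  then obtain k where k: "k \<le> d" "e = E k" by auto
  have "f = (\<lambda>x y. 0) \<or> f = E k"
    if "f \<in> range lin_comb" and idempotent: "cmat_mult X f f = f"
      and below: "cmat_mult X (E k) f = f" for f
  proof -
    obtain c where c: "f = lin_comb c" using \<open>f \<in> range lin_comb\<close> by blast
    have "of_bool (i = k) * c i = c i" if "i \<le> d" for i
      using below that unfolding c E_eq_lin_comb[OF k(1)] lin_comb_mult lin_comb_eq_iff by blast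
    then have "f = (\<lambda>x y. c k * E k x y)"
      unfolding c lin_comb_of_bool[OF k(1), symmetric]
      by (intro lin_comb_cong) (auto simp: mult.commute)
    moreover have "c k = 0 \<or> c k = 1"
      using idempotent k(1) unfolding c lin_comb_idempotent_iff by blast
    ultimately show ?thesis by auto
  qed
  with k show "primitive_idempotent X d R e"
    by (simp add: primitive_idempotent_def bose_mesner E_in_range_lin_comb E_nonzero E_mult_E)
qed

lemma inj_on_E: "inj_on E {..d}"
proof (rule inj_onI)
  fix i j assume "i \<in> {..d}" "j \<in> {..d}" "E i = E j"
  then show "i = j" using E_mult_E[of i j] E_mult_E[of i i] E_nonzero[of i] by (metis atMost_iff)
qed

end

locale scheme_eigenmatrices = orthogonal_idempotents X d E
  for X :: "'a set" and d E +
  fixes R :: "nat \<Rightarrow> ('a \<times> 'a) set" and P Q :: "nat \<Rightarrow> nat \<Rightarrow> real"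
  assumes finite_X: "finite X" and X_nonempty: "X \<noteq> {}"
    and first_eigenmatrix_P: "first_eigenmatrix d R E P"
    and second_eigenmatrix_Q: "second_eigenmatrix X d R E Q"
begin

lemma adjacency_eq_lin_comb: "j \<le> d \<Longrightarrow> adjacency (R j) = lin_comb (\<lambda>i. of_real (P i j))"
  using first_eigenmatrix_P by (simp add: first_eigenmatrix_def lin_comb_def)

lemma E_eq_sum_adjacency:
  "j \<le> d \<Longrightarrow> E j x y = (\<Sum>i\<le>d. of_real (Q i j) / of_nat (card X) * adjacency (R i) x y)"
  using second_eigenmatrix_Q by (simp add: second_eigenmatrix_def sum_divide_distrib)

lemma sum_adjacency_eq_lin_comb:
  "(\<lambda>x y. \<Sum>j\<le>d. c j * adjacency (R j) x y) = lin_comb (\<lambda>i. \<Sum>j\<le>d. c j * of_real (P i j))"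
proof (intro ext)
  fix x y
  have "(\<Sum>j\<le>d. c j * adjacency (R j) x y) = (\<Sum>j\<le>d. \<Sum>i\<le>d. c j * of_real (P i j) * E i x y)"
    by (simp add: adjacency_eq_lin_comb lin_comb_def sum_distrib_left mult.assoc)
  then show "(\<Sum>j\<le>d. c j * adjacency (R j) x y) = lin_comb (\<lambda>i. \<Sum>j\<le>d. c j * of_real (P i j)) x y"
    by (subst (asm) sum.swap) (simp add: lin_comb_def sum_distrib_right)
qed

lemma lin_comb_eq_sum_adjacency:
  "lin_comb c =
    (\<lambda>x y. \<Sum>i\<le>d. (\<Sum>j\<le>d. c j * (of_real (Q i j) / of_nat (card X))) * adjacency (R i) x y)"
proof (intro ext)
  fix x y
  have "lin_comb c x y =
      (\<Sum>j\<le>d. \<Sum>i\<le>d. c j * (of_real (Q i j) / of_nat (card X)) * adjacency (R i) x y)"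
    unfolding lin_comb_def
    by (intro sum.cong refl) (simp add: E_eq_sum_adjacency sum_distrib_left mult.assoc)
  then show "lin_comb c x y =
      (\<Sum>i\<le>d. (\<Sum>j\<le>d. c j * (of_real (Q i j) / of_nat (card X))) * adjacency (R i) x y)"
    by (subst (asm) sum.swap) (simp add: sum_distrib_right)
qed

lemma bose_mesner_eq: "bose_mesner d R = range lin_comb"
proof (intro equalityI subsetI)
  show "f \<in> range lin_comb" if "f \<in> bose_mesner d R" for f
    using that by (auto simp: bose_mesner_def sum_adjacency_eq_lin_comb)
  show "f \<in> bose_mesner d R" if "f \<in> range lin_comb" for f
    using that by (auto simp: bose_mesner_def lin_comb_eq_sum_adjacency)
qed

lemma idempotent_orderingI:
  assumes "E 0 = (\<lambda>x y. of_bool (x \<in> X \<and> y \<in> X) / of_nat (card X))"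
  shows "idempotent_ordering X d R E"
  using assms inj_on_E
  by (auto simp: idempotent_ordering_def bij_betw_def primitive_idempotent_iff[OF bose_mesner_eq])

lemma P_mult_Q:
  assumes "i \<le> d" "j \<le> d"
  shows "(\<Sum>k\<le>d. P i k * Q k j) = (if i = j then real (card X) else 0)"
proof -
  have "lin_comb (\<lambda>i. of_bool (i = j)) = E j"
    using assms by (simp add: E_eq_lin_comb)
  also have "\<dots> = lin_comb (\<lambda>i. \<Sum>k\<le>d. of_real (Q k j) / of_nat (card X) * of_real (P i k))"
    unfolding sum_adjacency_eq_lin_comb[symmetric] using assms(2) by (intro ext E_eq_sum_adjacency)
  finally have "of_bool (i = j) =
      (\<Sum>k\<le>d. of_real (Q k j) / of_nat (card X) * complex_of_real (P i k))"
    using assms by (simp add: lin_comb_eq_iff)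
  also have "\<dots> = of_real ((\<Sum>k\<le>d. P i k * Q k j) / real (card X))"
    by (simp add: sum_divide_distrib mult.commute)
  finally have "(\<Sum>k\<le>d. P i k * Q k j) / real (card X) = of_bool (i = j)"
    by (metis of_real_eq_iff of_real_0 of_real_1 of_bool_def)
  then show ?thesis
    using finite_X X_nonempty by (auto simp: field_simps split: if_splits)
qed

lemma intersection_number_eq:
  assumes disjoint: "\<And>i. i \<le> d \<Longrightarrow> i \<noteq> k \<Longrightarrow> R i \<inter> R k = {}"
    and ijk: "i \<le> d" "j \<le> d" "k \<le> d" and xy: "(x, y) \<in> R k"
  shows "of_nat (card {z \<in> X. (x, z) \<in> R i \<and> (z, y) \<in> R j}) =
    (\<Sum>l\<le>d. of_real (P l i * P l j * Q k l) / of_nat (card X) :: complex)"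
proof -
  have E_entry: "E l x y = of_real (Q k l) / of_nat (card X)" if "l \<le> d" for l
  proof -
    have "E l x y = (\<Sum>a\<le>d. if a = k then of_real (Q k l) / of_nat (card X) else 0)"
      unfolding E_eq_sum_adjacency[OF that] using disjoint xy
      by (intro sum.cong refl) (auto simp: adjacency_def)
    then show ?thesis using ijk(3) by simp
  qed
  have "of_nat (card {z \<in> X. (x, z) \<in> R i \<and> (z, y) \<in> R j}) =
      (\<Sum>z\<in>X. of_bool ((x, z) \<in> R i \<and> (z, y) \<in> R j) :: complex)"
    using finite_X by (simp add: sum_of_bool_eq Int_def)
  also have "\<dots> = cmat_mult X (adjacency (R i)) (adjacency (R j)) x y"
    by (simp add: cmat_mult_def adjacency_def of_bool_conj)
  also have "\<dots> = (\<Sum>l\<le>d. of_real (P l i) * of_real (P l j) * E l x y)"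
    using ijk by (simp add: adjacency_eq_lin_comb lin_comb_mult) (simp add: lin_comb_def)
  also have "\<dots> = (\<Sum>l\<le>d. of_real (P l i * P l j * Q k l) / of_nat (card X))"
    by (intro sum.cong refl) (simp add: E_entry)
  finally show ?thesis .
qed

end

lemma first_eigenmatrixI:
  assumes second: "second_eigenmatrix X d R E Q" and X: "card X > 0"
    and Q_mult_P: "\<And>i j. i \<le> d \<Longrightarrow> j \<le> d \<Longrightarrow>
      (\<Sum>k\<le>d. Q i k * P k j) = (if i = j then real (card X) else 0)"
  shows "first_eigenmatrix d R E P"
  unfolding first_eigenmatrix_def
proof (intro allI impI ext)
  fix j x y assume j: "j \<le> d"
  have "(\<Sum>i\<le>d. of_real (P i j) * E i x y) =
      (\<Sum>i\<le>d. \<Sum>k\<le>d. of_real (Q k i * P i j) / of_nat (card X) * adjacency (R k) x y)"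
    using second by (simp add: second_eigenmatrix_def sum_distrib_left sum_divide_distrib mult_ac)
  also have "\<dots> = (\<Sum>k\<le>d. of_real (\<Sum>i\<le>d. Q k i * P i j) / of_nat (card X) * adjacency (R k) x y)"
    by (subst sum.swap) (simp add: sum_distrib_right sum_divide_distrib)
  also have "\<dots> = (\<Sum>k\<le>d. if k = j then adjacency (R j) x y else 0)"
    using X j by (intro sum.cong refl) (simp add: Q_mult_P)
  finally show "adjacency (R j) x y = (\<Sum>i\<le>d. of_real (P i j) * E i x y)"
    using j by simp
qed

section \<open>Bicharacters of finite abelian groups\<close>

locale finite_comm_group = comm_group G for G (structure) +
  assumes finite_carrier [simp]: "finite (carrier G)"
begin

lemma card_carrier_pos: "card (carrier G) > 0"
  by (auto simp: card_gt_0_iff)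

lemma sum_character_eq_0:
  fixes f :: "'a \<Rightarrow> complex"
  assumes f: "\<And>x y. x \<in> carrier G \<Longrightarrow> y \<in> carrier G \<Longrightarrow> f (x \<otimes> y) = f x * f y"
    and a: "a \<in> carrier G" "f a \<noteq> 1"
  shows "(\<Sum>x\<in>carrier G. f x) = 0"
proof -
  have "(\<Sum>x\<in>carrier G. f x) = (\<Sum>x\<in>carrier G. f (a \<otimes> x))"
    by (rule sum.reindex_bij_witness[where j = "\<lambda>x. inv a \<otimes> x" and i = "\<lambda>x. a \<otimes> x"])
      (use a(1) in \<open>auto simp flip: m_assoc\<close>)
  also have "\<dots> = f a * (\<Sum>x\<in>carrier G. f x)"
    using a(1) by (simp add: f sum_distrib_left)
  finally show ?thesis using a(2) by simp
qed

end

locale bicharacter = G: finite_comm_group G + H: finite_comm_group H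
  for G :: "('a, 'c) monoid_scheme" and H :: "('b, 'd) monoid_scheme" +
  fixes chi :: "'a \<Rightarrow> 'b \<Rightarrow> complex"
  assumes chi_mult_left: "\<And>x x' y. x \<in> carrier G \<Longrightarrow> x' \<in> carrier G \<Longrightarrow> y \<in> carrier H \<Longrightarrow>
      chi (x \<otimes>\<^bsub>G\<^esub> x') y = chi x y * chi x' y"
    and chi_mult_right: "\<And>x y y'. x \<in> carrier G \<Longrightarrow> y \<in> carrier H \<Longrightarrow> y' \<in> carrier H \<Longrightarrow>
      chi x (y \<otimes>\<^bsub>H\<^esub> y') = chi x y * chi x y'"
    and chi_nonzero [simp]: "\<And>x y. x \<in> carrier G \<Longrightarrow> y \<in> carrier H \<Longrightarrow> chi x y \<noteq> 0"
    and nondegenerate_left: "\<And>x. x \<in> carrier G \<Longrightarrow> (\<And>y. y \<in> carrier H \<Longrightarrow> chi x y = 1) \<Longrightarrow> x = \<one>\<^bsub>G\<^esub>"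
    and nondegenerate_right: "\<And>y. y \<in> carrier H \<Longrightarrow> (\<And>x. x \<in> carrier G \<Longrightarrow> chi x y = 1) \<Longrightarrow> y = \<one>\<^bsub>H\<^esub>"
begin

lemma bicharacter_flip: "bicharacter H G (\<lambda>y x. chi x y)"
  by unfold_locales
    (auto simp: chi_mult_left chi_mult_right intro: nondegenerate_left nondegenerate_right)

lemma chi_one_left [simp]: "y \<in> carrier H \<Longrightarrow> chi \<one>\<^bsub>G\<^esub> y = 1"
  using chi_mult_left[of "\<one>\<^bsub>G\<^esub>" "\<one>\<^bsub>G\<^esub>" y] by simp

lemma chi_inv_left: "x \<in> carrier G \<Longrightarrow> y \<in> carrier H \<Longrightarrow> chi (inv\<^bsub>G\<^esub> x) y = inverse (chi x y)"
  using chi_mult_left[of x "inv\<^bsub>G\<^esub> x" y] by (simp add: field_simps)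

lemma chi_diff_left:
  "x \<in> carrier G \<Longrightarrow> z \<in> carrier G \<Longrightarrow> y \<in> carrier H \<Longrightarrow>
    chi (x \<otimes>\<^bsub>G\<^esub> inv\<^bsub>G\<^esub> z) y = chi x y * inverse (chi z y)"
  by (simp add: chi_mult_left chi_inv_left)

lemma sum_chi_right:
  assumes x: "x \<in> carrier G"
  shows "(\<Sum>y\<in>carrier H. chi x y) = (if x = \<one>\<^bsub>G\<^esub> then of_nat (card (carrier H)) else 0)"
proof (cases "x = \<one>\<^bsub>G\<^esub>")
  case False
  then obtain y where "y \<in> carrier H" "chi x y \<noteq> 1" using nondegenerate_left[OF x] by blast
  with x have "(\<Sum>y\<in>carrier H. chi x y) = 0"
    by (intro H.sum_character_eq_0[of _ y]) (auto simp: chi_mult_right)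
  with False show ?thesis by simp
qed simp

lemma chi_orthogonal_right:
  assumes "x \<in> carrier G" "z \<in> carrier G"
  shows "(\<Sum>y\<in>carrier H. chi x y * inverse (chi z y)) =
    (if x = z then of_nat (card (carrier H)) else 0)"
proof -
  have "(\<Sum>y\<in>carrier H. chi x y * inverse (chi z y)) = (\<Sum>y\<in>carrier H. chi (x \<otimes>\<^bsub>G\<^esub> inv\<^bsub>G\<^esub> z) y)"
    using assms by (simp add: chi_diff_left)
  then show ?thesis using assms by (simp add: sum_chi_right G.inv_solve_right')
qed

end

sublocale bicharacter \<subseteq> flip: bicharacter H G "\<lambda>y x. chi x y"
  by (rule bicharacter_flip)

context bicharacter
begin

lemma card_eq: "card (carrier G) = card (carrier H)"
proof -
  have "(\<Sum>x\<in>carrier G. \<Sum>y\<in>carrier H. chi x y) = (\<Sum>y\<in>carrier H. \<Sum>x\<in>carrier G. chi x y)"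
    by (rule sum.swap)
  then have "(of_nat (card (carrier H)) :: complex) = of_nat (card (carrier G))"
    by (simp add: sum_chi_right flip.sum_chi_right)
  then show ?thesis by simp
qed

definition right_character :: "'b \<Rightarrow> 'a \<Rightarrow> complex"
  where "right_character y = (\<lambda>x\<in>carrier G. chi x y)"

lemma right_character_closed: "y \<in> carrier H \<Longrightarrow> right_character y \<in> carrier (character_group G)"
  by (simp add: character_group_def right_character_def chi_mult_left)

lemma inj_on_right_character: "inj_on right_character (carrier H)"
proof (rule inj_onI)
  fix y y' assume y: "y \<in> carrier H" "y' \<in> carrier H" "right_character y = right_character y'"
  have "chi x y = chi x y'" if "x \<in> carrier G" for x
    using fun_cong[OF y(3), of x] that by (simp add: right_character_def)
  then have "(\<Sum>x\<in>carrier G. chi x y * inverse (chi x y')) = of_nat (card (carrier G))"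
    using y by simp
  with flip.chi_orthogonal_right[OF y(1,2)] G.card_carrier_pos show "y = y'"
    by (simp split: if_splits)
qed

text \<open>A character orthogonal to all \<open>right_character y\<close> would vanish at the identity.\<close>

lemma character_eq_right_character:
  assumes \<phi>: "\<phi> \<in> carrier (character_group G)"
  shows "\<exists>y\<in>carrier H. \<phi> = right_character y"
proof (rule ccontr)
  assume no: "\<not> ?thesis"
  have mult: "\<phi> (x \<otimes>\<^bsub>G\<^esub> z) = \<phi> x * \<phi> z" if "x \<in> carrier G" "z \<in> carrier G" for x z
    using \<phi> that by (simp add: character_group_def)
  have orthogonal: "(\<Sum>x\<in>carrier G. \<phi> x * inverse (chi x y)) = 0" if y: "y \<in> carrier H" for y
  proof -
    have "\<phi> \<in> extensional (carrier G)" using \<phi> by (simp add: character_group_def)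
    then obtain x where "x \<in> carrier G" "\<phi> x \<noteq> chi x y"
      using no y extensionalityI[of \<phi> "carrier G" "right_character y"]
      by (auto simp: right_character_def)
    then show ?thesis using y
      by (intro G.sum_character_eq_0[of _ x]) (auto simp: mult chi_mult_left field_simps)
  qed
  have "0 = (\<Sum>y\<in>carrier H. \<Sum>x\<in>carrier G. \<phi> x * inverse (chi x y))"
    by (simp add: orthogonal)
  also have "\<dots> = (\<Sum>x\<in>carrier G. \<phi> x * (\<Sum>y\<in>carrier H. chi \<one>\<^bsub>G\<^esub> y * inverse (chi x y)))"
    by (subst sum.swap) (simp add: sum_distrib_left)
  also have "\<dots> = (\<Sum>x\<in>carrier G. if \<one>\<^bsub>G\<^esub> = x then \<phi> x * of_nat (card (carrier H)) else 0)"
    using chi_orthogonal_right[of "\<one>\<^bsub>G\<^esub>"] by (intro sum.cong refl) (auto simp del: chi_one_left)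
  also have "\<dots> = \<phi> \<one>\<^bsub>G\<^esub> * of_nat (card (carrier H))"
    by simp
  finally show False
    using \<phi> H.card_carrier_pos by (simp add: character_group_def)
qed

lemma right_character_iso: "right_character \<in> iso H (character_group G)"
proof (rule isoI)
  show "right_character \<in> hom H (character_group G)"
  proof (rule homI)
    show "right_character (y \<otimes>\<^bsub>H\<^esub> y') = right_character y \<otimes>\<^bsub>character_group G\<^esub> right_character y'"
      if "y \<in> carrier H" "y' \<in> carrier H" for y y'
      using that by (auto simp: character_group_def right_character_def chi_mult_right fun_eq_iff)
  qed (rule right_character_closed)
  show "bij_betw right_character (carrier H) (carrier (character_group G))"
    using inj_on_right_character right_character_closed character_eq_right_character
    by (auto simp: bij_betw_def)
qed

lemma right_character_diff:
  assumes "y \<in> carrier H" "y' \<in> carrier H"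
  shows "right_character y \<otimes>\<^bsub>character_group G\<^esub> inv\<^bsub>character_group G\<^esub> right_character y' =
    right_character (y \<otimes>\<^bsub>H\<^esub> inv\<^bsub>H\<^esub> y')"
proof -
  interpret character: group "character_group G"
  proof (rule H.iso_imp_group)
    show "H \<cong> character_group G" using right_character_iso by (auto simp: is_iso_def)
    show "Group.monoid (character_group G)"
      by (rule monoidI) (auto simp: character_group_def extensional_def fun_eq_iff)
  qed
  interpret right_character: group_hom H "character_group G" right_character
    by unfold_locales (use right_character_iso in \<open>simp add: iso_def\<close>)
  show ?thesis using assms by simp
qed

end

section \<open>Symmetric partitions of abelian groups\<close>

lemma (in group) diff_rel_Collect_carrier:
  "X = carrier G \<Longrightarrow> diff_rel G {x \<in> X. p x} = diff_rel G {x. p x}"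
  by (auto simp: diff_rel_def)

locale symmetric_partition = finite_comm_group G for G (structure) +
  fixes d :: nat and D :: "nat \<Rightarrow> 'a set"
  assumes class_cover: "(\<Union>i\<le>d. D i) = carrier G"
    and class_disjoint: "\<And>i j. i \<le> d \<Longrightarrow> j \<le> d \<Longrightarrow> i \<noteq> j \<Longrightarrow> D i \<inter> D j = {}"
    and class_0: "D 0 = {\<one>}"
    and class_inv: "\<And>i x. i \<le> d \<Longrightarrow> x \<in> D i \<Longrightarrow> inv x \<in> D i"
begin

lemma class_subset: "i \<le> d \<Longrightarrow> D i \<subseteq> carrier G"
  using class_cover by auto

lemma class_closed: "i \<le> d \<Longrightarrow> x \<in> D i \<Longrightarrow> x \<in> carrier G"
  using class_subset by blast

lemma finite_class: "i \<le> d \<Longrightarrow> finite (D i)"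
  using class_subset finite_carrier finite_subset by blast

lemma class_unique: "i \<le> d \<Longrightarrow> j \<le> d \<Longrightarrow> x \<in> D i \<Longrightarrow> x \<in> D j \<longleftrightarrow> j = i"
  using class_disjoint by blast

lemma class_inv_iff: "i \<le> d \<Longrightarrow> x \<in> carrier G \<Longrightarrow> inv x \<in> D i \<longleftrightarrow> x \<in> D i"
  using class_inv[of i x] class_inv[of i "inv x"] by auto

definition Rel :: "nat \<Rightarrow> ('a \<times> 'a) set"
  where "Rel i = diff_rel G (D i)"

lemma Rel_iff: "(x, y) \<in> Rel i \<longleftrightarrow> x \<in> carrier G \<and> y \<in> carrier G \<and> x \<otimes> inv y \<in> D i"
  by (simp add: Rel_def diff_rel_def)

lemma Rel_0: "Rel 0 = Id_on (carrier G)"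
  by (auto simp: Rel_iff class_0 inv_solve_right')

lemma Rel_cover: "(\<Union>i\<le>d. Rel i) = carrier G \<times> carrier G"
proof (intro equalityI subsetI)
  fix p assume p: "p \<in> carrier G \<times> carrier G"
  then have "fst p \<otimes> inv snd p \<in> (\<Union>i\<le>d. D i)" unfolding class_cover by auto
  with p show "p \<in> (\<Union>i\<le>d. Rel i)" by (auto simp: Rel_iff)
qed (auto simp: Rel_iff)

lemma Rel_disjoint: "i \<le> d \<Longrightarrow> j \<le> d \<Longrightarrow> i \<noteq> j \<Longrightarrow> Rel i \<inter> Rel j = {}"
  unfolding disjoint_iff split_paired_All Rel_iff using class_unique by metis

lemma Rel_nonempty:
  assumes "i \<le> d" "D i \<noteq> {}"
  shows "Rel i \<noteq> {}"
proof -
  obtain x where "x \<in> D i" using assms(2) by blast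
  then have "(x, \<one>) \<in> Rel i" using class_closed[OF assms(1)] by (simp add: Rel_iff)
  then show ?thesis by blast
qed

lemma sym_Rel: "i \<le> d \<Longrightarrow> sym (Rel i)"
  using class_inv by (fastforce intro: symI simp: Rel_iff inv_mult_group)

lemma Rel_translate:
  assumes "(x, y) \<in> Rel i" and z: "z \<in> carrier G"
  shows "(x \<otimes> z, y \<otimes> z) \<in> Rel i"
proof -
  have xy: "x \<in> carrier G" "y \<in> carrier G" "x \<otimes> inv y \<in> D i" using assms by (auto simp: Rel_iff)
  then have "(x \<otimes> z) \<otimes> inv (y \<otimes> z) = x \<otimes> (z \<otimes> inv z) \<otimes> inv y"
    using z by (simp only: inv_mult_group m_assoc m_closed inv_closed)
  with xy z show ?thesis by (simp add: Rel_iff)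
qed

lemma abelian_schemeI:
  assumes nonempty: "\<And>i. i \<le> d \<Longrightarrow> D i \<noteq> {}"
    and intersection_numbers: "\<And>i j k x y x' y'. i \<le> d \<Longrightarrow> j \<le> d \<Longrightarrow> k \<le> d \<Longrightarrow>
      (x, y) \<in> Rel k \<Longrightarrow> (x', y') \<in> Rel k \<Longrightarrow>
      card {z \<in> carrier G. (x, z) \<in> Rel i \<and> (z, y) \<in> Rel j} =
      card {z \<in> carrier G. (x', z) \<in> Rel i \<and> (z, y') \<in> Rel j}"
  shows "abelian_scheme G d Rel"
  unfolding abelian_scheme_def association_scheme_def
proof (intro conjI allI impI)
  show "comm_group G" by (rule comm_group_axioms)
  show "\<exists>p. \<forall>(x, y)\<in>Rel k. card {z \<in> carrier G. (x, z) \<in> Rel i \<and> (z, y) \<in> Rel j} = p"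
    if "i \<le> d" "j \<le> d" "k \<le> d" for i j k
    using intersection_numbers[OF that] by (cases "Rel k = {}") (blast, fast)
  show "\<forall>(x, y)\<in>Rel i. \<forall>z\<in>carrier G. (x \<otimes> z, y \<otimes> z) \<in> Rel i" for i
    by (auto intro: Rel_translate)
qed (auto simp: Rel_0 Rel_cover Rel_disjoint nonempty[THEN [2] Rel_nonempty] sym_Rel)

end

section \<open>Dual partitions and their schemes\<close>

locale dual_partitions =
  bicharacter G H chi + G: symmetric_partition G d D + H: symmetric_partition H d D'
  for G :: "('a, 'c) monoid_scheme" and H :: "('b, 'd) monoid_scheme" and chi d D D' +
  fixes P Q :: "nat \<Rightarrow> nat \<Rightarrow> real"
  assumes Q_sum: "\<And>i j x. i \<le> d \<Longrightarrow> j \<le> d \<Longrightarrow> x \<in> D i \<Longrightarrow> (\<Sum>y\<in>D' j. chi x y) = of_real (Q i j)"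
    and Q_mult_P: "\<And>i j. i \<le> d \<Longrightarrow> j \<le> d \<Longrightarrow>
      (\<Sum>k\<le>d. Q i k * P k j) = (if i = j then real (card (carrier G)) else 0)"
    and right_class_nonempty: "\<And>j. j \<le> d \<Longrightarrow> D' j \<noteq> {}"
begin

abbreviation n :: nat
  where "n \<equiv> card (carrier G)"

definition idem :: "nat \<Rightarrow> 'a cmatrix"
  where "idem j x z = (if x \<in> carrier G \<and> z \<in> carrier G
    then (\<Sum>y\<in>D' j. chi x y * inverse (chi z y)) / of_nat n else 0)"

lemma idem_mult_chi:
  assumes j: "j \<le> d" and x: "x \<in> carrier G" and h: "h \<in> carrier H"
  shows "(\<Sum>z\<in>carrier G. idem j x z * chi z h) = chi x h * of_bool (h \<in> D' j)"
proof -
  have "(\<Sum>z\<in>carrier G. idem j x z * chi z h) =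
      (\<Sum>z\<in>carrier G. \<Sum>y\<in>D' j. chi x y / of_nat n * (chi z h * inverse (chi z y)))"
    using x by (intro sum.cong refl)
      (simp add: idem_def sum_distrib_left sum_distrib_right sum_divide_distrib mult_ac)
  also have "\<dots> = (\<Sum>y\<in>D' j. chi x y / of_nat n * (\<Sum>z\<in>carrier G. chi z h * inverse (chi z y)))"
    by (subst sum.swap) (simp add: sum_distrib_left)
  also have "\<dots> = (\<Sum>y\<in>D' j. if h = y then chi x y else 0)"
    using h H.class_closed[OF j] G.card_carrier_pos
    by (intro sum.cong refl) (auto simp: flip.chi_orthogonal_right)
  also have "\<dots> = chi x h * of_bool (h \<in> D' j)"
    using H.finite_class[OF j] by simp
  finally show ?thesis .
qed

lemma idem_mult_idem:
  assumes "i \<le> d" "j \<le> d"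
  shows "cmat_mult (carrier G) (idem i) (idem j) = (if i = j then idem i else (\<lambda>x y. 0))"
proof (intro ext)
  fix x z
  show "cmat_mult (carrier G) (idem i) (idem j) x z = (if i = j then idem i else (\<lambda>x y. 0)) x z"
  proof (cases "x \<in> carrier G \<and> z \<in> carrier G")
    case True
    have "cmat_mult (carrier G) (idem i) (idem j) x z =
        (\<Sum>w\<in>carrier G. \<Sum>y\<in>D' j. inverse (chi z y) / of_nat n * (idem i x w * chi w y))"
      unfolding cmat_mult_def using True by (intro sum.cong refl)
        (simp add: idem_def[of j] sum_distrib_left sum_divide_distrib mult_ac)
    also have "\<dots> = (\<Sum>y\<in>D' j. inverse (chi z y) / of_nat n * (\<Sum>w\<in>carrier G. idem i x w * chi w y))"
      by (subst sum.swap) (simp add: sum_distrib_left)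
    also have "\<dots> = (\<Sum>y\<in>D' j. inverse (chi z y) / of_nat n * (chi x y * of_bool (i = j)))"
      using True assms H.class_closed[of j] H.class_unique[of j i]
      by (intro sum.cong refl) (subst idem_mult_chi, auto)
    also have "\<dots> = (if i = j then idem i else (\<lambda>x y. 0)) x z"
      using True by (simp add: idem_def sum_divide_distrib mult.commute)
    finally show ?thesis .
  qed (auto simp: cmat_mult_def idem_def)
qed

lemma idem_nonzero:
  assumes j: "j \<le> d"
  shows "idem j \<noteq> (\<lambda>x y. 0)"
proof
  assume "idem j = (\<lambda>x y. 0)"
  then have "idem j \<one>\<^bsub>G\<^esub> \<one>\<^bsub>G\<^esub> = 0" by simp
  moreover have "idem j \<one>\<^bsub>G\<^esub> \<one>\<^bsub>G\<^esub> = of_nat (card (D' j)) / of_nat n"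
    using H.class_closed[OF j] by (simp add: idem_def)
  ultimately show False
    using G.card_carrier_pos H.finite_class[OF j] right_class_nonempty[OF j] by simp
qed

lemma idem_0: "idem 0 = (\<lambda>x y. of_bool (x \<in> carrier G \<and> y \<in> carrier G) / of_nat n)"
  by (auto simp: fun_eq_iff idem_def H.class_0)

lemma second_eigenmatrix_idem: "second_eigenmatrix (carrier G) d G.Rel idem Q"
  unfolding second_eigenmatrix_def
proof (intro allI impI ext)
  fix j x z assume j: "j \<le> d"
  show "idem j x z = 1 / of_nat n * (\<Sum>i\<le>d. of_real (Q i j) * adjacency (G.Rel i) x z)"
  proof (cases "x \<in> carrier G \<and> z \<in> carrier G")
    case True
    then have "x \<otimes>\<^bsub>G\<^esub> inv\<^bsub>G\<^esub> z \<in> (\<Union>i\<le>d. D i)" unfolding G.class_cover by simp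
    then obtain k where k: "k \<le> d" "x \<otimes>\<^bsub>G\<^esub> inv\<^bsub>G\<^esub> z \<in> D k" by auto
    have "(\<Sum>i\<le>d. of_real (Q i j) * adjacency (G.Rel i) x z) =
        (\<Sum>i\<le>d. if i = k then of_real (Q i j) else (0::complex))"
      using True G.class_unique[OF k(1) _ k(2)]
      by (intro sum.cong refl) (auto simp: adjacency_def G.Rel_iff)
    also have "\<dots> = (\<Sum>y\<in>D' j. chi (x \<otimes>\<^bsub>G\<^esub> inv\<^bsub>G\<^esub> z) y)"
      using Q_sum[OF k(1) j k(2)] k(1) by simp
    also have "\<dots> = (\<Sum>y\<in>D' j. chi x y * inverse (chi z y))"
      using True H.class_closed[OF j] by (simp add: chi_diff_left)
    finally show ?thesis using True by (simp add: idem_def)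
  qed (auto simp: idem_def adjacency_def G.Rel_iff)
qed

end

sublocale dual_partitions \<subseteq> scheme_eigenmatrices "carrier G" d idem G.Rel P Q
proof unfold_locales
  show "first_eigenmatrix d G.Rel idem P"
    using second_eigenmatrix_idem G.card_carrier_pos Q_mult_P by (rule first_eigenmatrixI)
qed (auto simp: idem_mult_idem idem_nonzero intro: second_eigenmatrix_idem)

context dual_partitions
begin

lemma idempotent_ordering_idem: "idempotent_ordering (carrier G) d G.Rel idem"
  by (rule idempotent_orderingI[OF idem_0])

lemma left_class_nonempty:
  assumes j: "j \<le> d"
  shows "D j \<noteq> {}"
proof
  assume "D j = {}"
  then have "lin_comb (\<lambda>i. of_real (P i j)) = lin_comb (\<lambda>i. 0)"
    by (simp add: lin_comb_0 adjacency_def G.Rel_iff fun_eq_iff flip: adjacency_eq_lin_comb[OF j])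
  then have "P i j = 0" if "i \<le> d" for i using that by (simp add: lin_comb_eq_iff)
  with Q_mult_P[OF j j] G.card_carrier_pos show False by simp
qed

lemma abelian_scheme_Rel: "abelian_scheme G d G.Rel"
proof (rule G.abelian_schemeI)
  fix i j k x y x' y'
  assume ijk: "i \<le> d" "j \<le> d" "k \<le> d" and xy: "(x, y) \<in> G.Rel k" "(x', y') \<in> G.Rel k"
  have disjoint: "G.Rel l \<inter> G.Rel k = {}" if "l \<le> d" "l \<noteq> k" for l
    using that ijk(3) by (intro G.Rel_disjoint)
  note number = intersection_number_eq[OF disjoint ijk]
  show "card {z \<in> carrier G. (x, z) \<in> G.Rel i \<and> (z, y) \<in> G.Rel j} =
      card {z \<in> carrier G. (x', z) \<in> G.Rel i \<and> (z, y') \<in> G.Rel j}"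
    using number[OF _ _ xy(1)] number[OF _ _ xy(2)] by (metis (no_types, lifting) of_nat_eq_iff)
qed (rule left_class_nonempty)

text \<open>The entries of \<open>P\<close> are the eigenvalues of the adjacency matrices on the characters.\<close>

lemma P_sum:
  assumes i: "i \<le> d" and j: "j \<le> d" and y: "y \<in> D' i"
  shows "(\<Sum>x\<in>D j. chi x y) = of_real (P i j)"
proof -
  have yH: "y \<in> carrier H" using H.class_closed[OF i y] .
  have "(\<Sum>x\<in>D j. chi x y) = (\<Sum>x\<in>carrier G. adjacency (G.Rel j) \<one>\<^bsub>G\<^esub> x * chi x y)"
    using G.class_subset[OF j] G.class_inv_iff[OF j]
    by (intro sum.mono_neutral_cong_left) (auto simp: adjacency_def G.Rel_iff)
  also have "\<dots> = (\<Sum>x\<in>carrier G. \<Sum>k\<le>d. of_real (P k j) * (idem k \<one>\<^bsub>G\<^esub> x * chi x y))"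
    unfolding adjacency_eq_lin_comb[OF j] lin_comb_def by (simp add: sum_distrib_right mult.assoc)
  also have "\<dots> = (\<Sum>k\<le>d. of_real (P k j) * (\<Sum>x\<in>carrier G. idem k \<one>\<^bsub>G\<^esub> x * chi x y))"
    by (subst sum.swap) (simp add: sum_distrib_left)
  also have "\<dots> = (\<Sum>k\<le>d. if k = i then of_real (P i j) else 0)"
    using yH H.class_unique[OF i _ y] by (intro sum.cong refl) (auto simp: idem_mult_chi)
  finally show ?thesis using i by simp
qed

lemma dual_partitions_flip: "dual_partitions H G (\<lambda>y x. chi x y) d D' D Q P"
  using P_sum P_mult_Q left_class_nonempty by unfold_locales (simp_all add: card_eq)

lemma idem_fixes_right_character_iff:
  assumes j: "j \<le> d" and h: "h \<in> carrier H"
  shows "(\<forall>x\<in>carrier G. (\<Sum>z\<in>carrier G. idem j x z * right_character h z) = right_character h x) \<longleftrightarrow>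
    h \<in> D' j"
proof -
  have "(\<Sum>z\<in>carrier G. idem j x z * right_character h z) = chi x h * of_bool (h \<in> D' j)"
    if "x \<in> carrier G" for x
    using idem_mult_chi[OF j that h] by (simp add: right_character_def)
  then have "(\<forall>x\<in>carrier G.
        (\<Sum>z\<in>carrier G. idem j x z * right_character h z) = right_character h x) \<longleftrightarrow>
      (\<forall>x\<in>carrier G. chi x h * of_bool (h \<in> D' j) = chi x h)"
    by (simp add: right_character_def)
  also have "\<dots> \<longleftrightarrow> h \<in> D' j"
    using h G.one_closed by (auto simp: of_bool_def)
  finally show ?thesis .
qed

lemma dual_relation_iff:
  assumes "j \<le> d" "y \<in> carrier H" "y' \<in> carrier H"
  shows "(right_character y, right_character y') \<in> dual_relation G idem j \<longleftrightarrow> (y, y') \<in> H.Rel j"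
  using assms
  by (simp add: dual_relation_def diff_rel_def H.Rel_iff right_character_closed right_character_diff
      idem_fixes_right_character_iff)

lemma dual_scheme_viaI:
  assumes "nondegenerate_pairing G H \<beta>" and "pairing_character G \<beta> = right_character"
  shows "dual_scheme_via G idem H d H.Rel \<beta>"
  using assms by (simp add: dual_scheme_via_def right_character_iso dual_relation_iff)

end

section \<open>Quadratic forms with values in the integers modulo 4\<close>

declare add_bit_eq_xor [simp del] mult_bit_eq_and [simp del] minus_bit_def [simp del]

lemma exhaust_Z4:
  fixes a :: 4
  obtains (zero) "a = 0" | (one) "a = 1" | (two) "a = 2" | (three) "a = 3"
  using exhaust_4[of a] by auto

lemma twice_twice_Z4: "2 * (2 * a) = (0 :: 4)"
  by (cases a rule: exhaust_Z4) simp_all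

lemma lift4_simps [simp]: "lift4 0 = 0" "lift4 1 = 1"
  by (simp_all add: lift4_def)

lemma lift4_add: "lift4 (a + b) = lift4 a + lift4 b + 2 * (lift4 a * lift4 b)"
  by (cases a; cases b) (simp_all add: lift4_def)

lemma lift4_mult: "lift4 (a * b) = lift4 a * lift4 b"
  by (cases a; cases b) (simp_all add: lift4_def)

lemma twice_lift4_add: "2 * lift4 (a + b) = 2 * lift4 a + 2 * lift4 b"
  unfolding lift4_add distrib_left twice_twice_Z4 by (simp only: add_0_right)

lemma twice_lift4_sum: "2 * lift4 (\<Sum>x\<in>A. f x) = (\<Sum>x\<in>A. 2 * lift4 (f x))"
  by (induction A rule: infinite_finite_induct) (simp_all add: twice_lift4_add)

type_synonym 'm bmat = "((bit, 'm) vec, 'm) vec"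

abbreviation symmetric_matrix :: "'m::finite bmat \<Rightarrow> bool"
  where "symmetric_matrix R \<equiv> Finite_Cartesian_Product.transpose R = R"

lemma symmetric_matrix_entry: "symmetric_matrix R \<Longrightarrow> R $ i $ j = R $ j $ i"
  by (simp add: transpose_def vec_eq_iff)

definition twice_dot :: "'m::finite bvec \<Rightarrow> 'm bvec \<Rightarrow> 4"
  where "twice_dot u v = 2 * (\<Sum>i\<in>UNIV. lift4 (u $ i) * lift4 (v $ i))"

lemma twice_dot_eq_sum: "twice_dot u v = (\<Sum>i\<in>UNIV. 2 * lift4 (u $ i * v $ i))"
  by (simp add: twice_dot_def lift4_mult sum_distrib_left)

lemma twice_dot_commute: "twice_dot u v = twice_dot v u"
  by (simp add: twice_dot_def mult.commute)

lemma twice_dot_add_right: "twice_dot u (v + w) = twice_dot u v + twice_dot u w"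
  by (simp only: twice_dot_eq_sum vector_add_component distrib_left twice_lift4_add sum.distrib)

lemma twice_dot_add_left: "twice_dot (u + v) w = twice_dot u w + twice_dot v w"
  by (simp only: twice_dot_commute[of _ w] twice_dot_add_right)

lemma twice_dot_diff_right: "twice_dot u (v - w) = twice_dot u v - twice_dot u w"
  using twice_dot_add_right[of u "v - w" w] by (simp add: eq_diff_eq)

lemma twice_dot_0 [simp]: "twice_dot 0 v = 0" "twice_dot v 0 = 0"
  by (simp_all add: twice_dot_def)

lemma twice_twice_dot [simp]: "2 * twice_dot u v = 0"
  unfolding twice_dot_def by (rule twice_twice_Z4)

lemma twice_dot_axis: "twice_dot (axis k 1) v = 2 * lift4 (v $ k)"
proof -
  have "twice_dot (axis k 1) v = (\<Sum>i\<in>UNIV. if i = k then 2 * lift4 (v $ k) else 0)"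
    unfolding twice_dot_def sum_distrib_left by (intro sum.cong refl) (auto simp: axis_def)
  then show ?thesis by simp
qed

lemma twice_dot_eq_0D:
  assumes "\<And>u. twice_dot u v = 0"
  shows "v = 0"
proof -
  have "v $ k = 0" for k
    using assms[of "axis k 1"] by (cases "v $ k") (simp_all add: twice_dot_axis)
  then show ?thesis by (simp add: vec_eq_iff)
qed

lemma twice_dot_eqD: "(\<And>u. twice_dot u v = twice_dot u w) \<Longrightarrow> v = w"
  using twice_dot_eq_0D[of "v - w"] by (simp add: twice_dot_diff_right)

definition lift_form :: "'m::finite bmat \<Rightarrow> ('m \<Rightarrow> 4) \<Rightarrow> ('m \<Rightarrow> 4) \<Rightarrow> 4"
  where "lift_form R x y = (\<Sum>i\<in>UNIV. \<Sum>j\<in>UNIV. lift4 (R $ i $ j) * x i * y j)"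

lemma lift_form_add_left: "lift_form R (\<lambda>i. x i + y i) z = lift_form R x z + lift_form R y z"
  by (simp add: lift_form_def algebra_simps sum.distrib)

lemma lift_form_add_right: "lift_form R x (\<lambda>i. y i + z i) = lift_form R x y + lift_form R x z"
  by (simp add: lift_form_def algebra_simps sum.distrib)

lemma lift_form_scale:
  "lift_form R (\<lambda>i. c * x i) y = c * lift_form R x y"
  "lift_form R x (\<lambda>i. c * y i) = c * lift_form R x y"
  by (simp_all add: lift_form_def sum_distrib_left mult_ac)

lemma lift_form_commute:
  assumes "symmetric_matrix R"
  shows "lift_form R x y = lift_form R y x"
  unfolding lift_form_def
  by (subst sum.swap) (simp add: symmetric_matrix_entry[OF assms] mult_ac)

lemma lift_form_add_diagonal:
  assumes "symmetric_matrix R"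
  shows "lift_form R (\<lambda>i. x i + y i) (\<lambda>i. x i + y i) =
    lift_form R x x + lift_form R y y + 2 * lift_form R x y"
  using lift_form_commute[OF assms, of y x] by (simp add: lift_form_add_left lift_form_add_right)

lemma lift_form_add_twice_diagonal:
  assumes "symmetric_matrix R"
  shows "lift_form R (\<lambda>i. x i + 2 * t i) (\<lambda>i. x i + 2 * t i) = lift_form R x x"
  unfolding lift_form_add_diagonal[OF assms] lift_form_scale twice_twice_Z4 by simp

lemma twice_lift_form:
  "2 * lift_form R (\<lambda>i. lift4 (u $ i)) (\<lambda>j. lift4 (v $ j)) = twice_dot u (R *v v)"
proof -
  have "twice_dot u (R *v v) = 2 * lift4 (\<Sum>i\<in>UNIV. \<Sum>j\<in>UNIV. u $ i * (R $ i $ j * v $ j))"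
    by (simp only: twice_dot_eq_sum matrix_vector_mult_def vec_lambda_beta sum_distrib_left
        twice_lift4_sum)
  then show ?thesis
    by (simp only: twice_lift4_sum lift4_mult lift_form_def sum_distrib_left mult_ac)
qed

lemma sum_symmetric_eq_diagonal_plus_twice:
  fixes f :: "'m::{finite,linorder} \<Rightarrow> 'm \<Rightarrow> 'a::comm_semiring_1"
  assumes sym: "\<And>i j. f i j = f j i"
  shows "(\<Sum>i\<in>UNIV. \<Sum>j\<in>UNIV. f i j) = (\<Sum>i\<in>UNIV. f i i) + 2 * (\<Sum>i\<in>UNIV. \<Sum>j | i < j. f i j)"
proof -
  have "(\<Sum>j\<in>UNIV. f i j) = f i i + ((\<Sum>j | i < j. f i j) + (\<Sum>j | j < i. f i j))" for i
  proof -
    have "(UNIV :: 'm set) = insert i ({j. i < j} \<union> {j. j < i})" by auto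
    then have "(\<Sum>j\<in>UNIV. f i j) = f i i + (\<Sum>j\<in>{j. i < j} \<union> {j. j < i}. f i j)"
      by (simp add: sum.insert[symmetric])
    then show ?thesis by (subst (asm) sum.union_disjoint) auto
  qed
  moreover have "(\<Sum>i\<in>UNIV. \<Sum>j | j < i. f i j) = (\<Sum>i\<in>UNIV. \<Sum>j | i < j. f i j)"
    using sum.swap_restrict[of "UNIV :: 'm set" "UNIV :: 'm set" f "\<lambda>i j. j < i"] sym by simp
  ultimately show ?thesis by (simp add: sum.distrib mult_2)
qed

lemma quad_form_eq_lift_form:
  assumes "symmetric_matrix R"
  shows "quad_form R v = lift_form R (\<lambda>i. lift4 (v $ i)) (\<lambda>i. lift4 (v $ i))"
  unfolding lift_form_def quad_form_def
  by (subst sum_symmetric_eq_diagonal_plus_twice)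
    (simp_all add: symmetric_matrix_entry[OF assms] power2_eq_square mult_ac)

lemma quad_form_add:
  assumes "symmetric_matrix R"
  shows "quad_form R (u + v) = quad_form R u + quad_form R v + twice_dot u (R *v v)"
proof -
  have "quad_form R (u + v) = lift_form R
      (\<lambda>i. (lift4 (u $ i) + lift4 (v $ i)) + 2 * (lift4 (u $ i) * lift4 (v $ i)))
      (\<lambda>i. (lift4 (u $ i) + lift4 (v $ i)) + 2 * (lift4 (u $ i) * lift4 (v $ i)))"
    by (simp only: quad_form_eq_lift_form[OF assms] vector_add_component lift4_add)
  also have "\<dots> = quad_form R u + quad_form R v + twice_dot u (R *v v)"
    by (simp only: lift_form_add_twice_diagonal[OF assms] lift_form_add_diagonal[OF assms]
        quad_form_eq_lift_form[OF assms] twice_lift_form)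
  finally show ?thesis .
qed

lemma quad_form_0 [simp]: "quad_form R 0 = 0" "quad_form 0 v = 0"
  by (simp_all add: quad_form_def)

definition diag_vec :: "'m bmat \<Rightarrow> 'm::finite bvec"
  where "diag_vec R = (\<chi> i. R $ i $ i)"

lemma diag_vec_diff: "diag_vec (R - R') = diag_vec R - diag_vec R'"
  by (simp add: diag_vec_def vec_eq_iff)

lemma twice_quad_form: "2 * quad_form R v = twice_dot (diag_vec R) v"
proof -
  have "(lift4 b)\<^sup>2 = lift4 b" for b by (cases b) simp_all
  then show ?thesis
    unfolding quad_form_def distrib_left twice_twice_Z4 by (simp add: twice_dot_def diag_vec_def)
qed

section \<open>Exponential sums\<close>

lemma i_power_simps [simp]:
  "i_power 0 = 1" "i_power 1 = \<i>" "i_power 2 = -1" "i_power 3 = -\<i>"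
  by (simp_all add: i_power_def)

lemma i_power_add: "i_power (a + b) = i_power a * i_power b"
  by (cases a rule: exhaust_Z4; cases b rule: exhaust_Z4; simp add: i_power_def)

lemma i_power_nonzero [simp]: "i_power a \<noteq> 0"
  by (simp add: i_power_def)

lemma i_power_eq_1_iff: "i_power a = 1 \<longleftrightarrow> a = 0"
  by (cases a rule: exhaust_Z4) (auto simp: complex_eq_iff)

lemma i_power_mult_cnj: "i_power a * cnj (i_power a) = 1"
  by (cases a rule: exhaust_Z4) simp_all

lemma i_power_uminus: "i_power (- a) = cnj (i_power a)"
proof -
  have "i_power a * i_power (- a) = i_power a * cnj (i_power a)"
    by (simp add: i_power_mult_cnj flip: i_power_add)
  then show ?thesis by simp
qed

lemma i_power_diff: "i_power (a - b) = i_power a * cnj (i_power b)"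
  using i_power_add[of a "- b"] by (simp add: i_power_uminus)

definition exp_sum :: "'v set \<Rightarrow> ('v \<Rightarrow> 4) \<Rightarrow> complex"
  where "exp_sum I x = (\<Sum>v\<in>I. i_power (x v))"

lemma exp_sum_cong: "(\<And>v. v \<in> I \<Longrightarrow> x v = y v) \<Longrightarrow> exp_sum I x = exp_sum I y"
  by (simp add: exp_sum_def)

lemma exp_sum_const: "exp_sum I (\<lambda>v. c) = of_nat (card I) * i_power c"
  by (simp add: exp_sum_def)

lemma exp_sum_add_const: "exp_sum I (\<lambda>v. x v + c) = exp_sum I x * i_power c"
  by (simp add: exp_sum_def i_power_add sum_distrib_right)

lemma exp_sum_uminus: "exp_sum I (\<lambda>v. - x v) = cnj (exp_sum I x)"
  by (simp add: exp_sum_def i_power_uminus)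

lemma exp_sum_insert: "finite I \<Longrightarrow> i \<notin> I \<Longrightarrow> exp_sum (insert i I) x = i_power (x i) + exp_sum I x"
  by (simp add: exp_sum_def)

lemma sum_i_power_off_diagonal:
  assumes "finite J"
  shows "(\<Sum>(k, l) | k \<in> J \<and> l \<in> J \<and> k \<noteq> l. i_power (x k - x l)) =
    exp_sum J x * cnj (exp_sum J x) - of_nat (card J)"
proof -
  have J: "J \<times> J = {(k, l). k \<in> J \<and> l \<in> J \<and> k \<noteq> l} \<union> (\<lambda>k. (k, k)) ` J" by auto
  have "exp_sum J x * cnj (exp_sum J x) = (\<Sum>(k, l)\<in>J \<times> J. i_power (x k - x l))"
    by (simp add: exp_sum_def sum_product sum.cartesian_product i_power_diff)
  also have "\<dots> = (\<Sum>(k, l) | k \<in> J \<and> l \<in> J \<and> k \<noteq> l. i_power (x k - x l)) +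
      (\<Sum>(k, l)\<in>(\<lambda>k. (k, k)) ` J. i_power (x k - x l))"
    unfolding J
    by (rule sum.union_disjoint) (use assms in \<open>auto intro: finite_subset[of _ "J \<times> J"]\<close>)
  also have "(\<Sum>(k, l)\<in>(\<lambda>k. (k, k)) ` J. i_power (x k - x l)) = of_nat (card J)"
    by (simp add: sum.reindex inj_on_def)
  finally show ?thesis by simp
qed

lemma exp_sum_gaussian_integer:
  obtains a b :: int where "exp_sum I x = Complex (of_int a) (of_int b)"
proof -
  have "Re (i_power c) \<in> \<int>" "Im (i_power c) \<in> \<int>" for c
    by (cases c rule: exhaust_Z4; simp)+
  then have "Re (exp_sum I x) \<in> \<int>" "Im (exp_sum I x) \<in> \<int>"
    by (auto simp: exp_sum_def intro!: Ints_sum)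
  then obtain a b where "Re (exp_sum I x) = of_int a" "Im (exp_sum I x) = of_int b"
    by (auto elim!: Ints_cases)
  then show ?thesis using that[of a b] by (simp add: complex_eq_iff)
qed

lemma lee_weight_eq_exp_sum: "real (lee_weight I x) = real (card I) - Re (exp_sum I x)"
proof -
  have "real (lee_weight1 a) = 1 - Re (i_power a)" for a
    by (cases a rule: exhaust_Z4) (simp_all add: lee_weight1_def)
  then show ?thesis by (simp add: lee_weight_def exp_sum_def sum_subtractf)
qed

lemma sum_two_squares_eq_odd_power_of_2:
  fixes a b :: int
  assumes "a\<^sup>2 + b\<^sup>2 = 2 ^ (2 * k + 1)"
  shows "a\<^sup>2 = 2 ^ (2 * k) \<and> b\<^sup>2 = 2 ^ (2 * k)"
  using assms
proof (induction k arbitrary: a b)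
  case 0
  have "c\<^sup>2 \<noteq> 2" for c :: int
  proof
    assume c: "c\<^sup>2 = 2"
    then have "even c" by (metis even_numeral even_power)
    then obtain e where "c = 2 * e" by (elim evenE)
    with c have "4 * e\<^sup>2 = 2" by (simp add: power_mult_distrib)
    then show False by presburger
  qed
  moreover have "a\<^sup>2 \<ge> 0" "b\<^sup>2 \<ge> 0" "a\<^sup>2 + b\<^sup>2 = 2" using 0 by simp_all
  ultimately have "a\<^sup>2 = 1" "b\<^sup>2 = 1" by (smt (verit))+
  then show ?case by simp
next
  case (Suc k)
  have "even (a\<^sup>2 + b\<^sup>2)" unfolding Suc.prems by simp
  then have same_parity: "even a \<longleftrightarrow> even b" by simp
  have "even a"
  proof (rule ccontr)
    assume "odd a"
    then obtain s t where "a = 2 * s + 1" "b = 2 * t + 1" using same_parity by (meson oddE)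
    then have "a\<^sup>2 + b\<^sup>2 = 4 * (s\<^sup>2 + s + t\<^sup>2 + t) + 2" by (simp add: power2_eq_square algebra_simps)
    with Suc.prems have "4 * (s\<^sup>2 + s + t\<^sup>2 + t) + 2 = 4 * (2 * 2 ^ (2 * k))" by simp
    then show False by presburger
  qed
  with same_parity obtain s t where st: "a = 2 * s" "b = 2 * t" by (meson evenE)
  with Suc.prems have "s\<^sup>2 + t\<^sup>2 = 2 ^ (2 * k + 1)" by (simp add: power_mult_distrib)
  from Suc.IH[OF this] st show ?case by (simp add: power_mult_distrib)
qed

lemma exp_sum_Re_Im_squared:
  assumes "exp_sum I x * cnj (exp_sum I x) = 2 ^ m" and "odd m"
  shows "(Re (exp_sum I x))\<^sup>2 = 2 ^ (m - 1)" and "(Im (exp_sum I x))\<^sup>2 = 2 ^ (m - 1)"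
proof -
  obtain a b where ab: "exp_sum I x = Complex (of_int a) (of_int b)"
    by (rule exp_sum_gaussian_integer)
  obtain k where k: "m = 2 * k + 1" using \<open>odd m\<close> by (elim oddE)
  have "complex_of_real (of_int (a\<^sup>2 + b\<^sup>2)) = of_real (of_int (2 ^ m))"
    using assms(1) unfolding ab complex_mult_cnj by simp
  then have "a\<^sup>2 + b\<^sup>2 = 2 ^ (2 * k + 1)" unfolding of_real_eq_iff of_int_eq_iff k .
  from sum_two_squares_eq_odd_power_of_2[OF this]
  have "real_of_int (a\<^sup>2) = of_int (2 ^ (m - 1))" "real_of_int (b\<^sup>2) = of_int (2 ^ (m - 1))"
    by (simp_all add: k)
  then show "(Re (exp_sum I x))\<^sup>2 = 2 ^ (m - 1)" "(Im (exp_sum I x))\<^sup>2 = 2 ^ (m - 1)"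
    by (simp_all add: ab)
qed

section \<open>Words of quadratic forms\<close>

lemma UNIV_bit: "(UNIV :: bit set) = {0, 1}"
  using bit.exhaust by auto

instance bit :: finite
  by standard (simp add: UNIV_bit)

lemma CARD_bit: "CARD(bit) = 2"
  by (simp add: UNIV_bit)

lemma CARD_bvec: "CARD('m::finite bvec) = 2 ^ CARD('m)"
  by (simp add: CARD_bit)

lemma sum_translate:
  fixes f :: "'a::{ab_group_add,finite} \<Rightarrow> 'b::comm_monoid_add"
  shows "(\<Sum>v\<in>UNIV. f (v + w)) = (\<Sum>v\<in>UNIV. f v)"
  by (rule sum.reindex_bij_witness[where i = "\<lambda>v. v - w" and j = "\<lambda>v. v + w"]) auto

lemma exp_sum_twice_dot:
  fixes w :: "'m::finite bvec"
  shows "exp_sum UNIV (\<lambda>v. twice_dot v w) = (if w = 0 then 2 ^ CARD('m) else 0)"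
proof (cases "w = 0")
  case True
  then show ?thesis by (simp add: exp_sum_const CARD_bvec del: CARD_vec)
next
  case False
  then obtain u where u: "twice_dot u w \<noteq> 0" using twice_dot_eq_0D by blast
  moreover have "2 * twice_dot u w = 0" by simp
  ultimately have minus: "i_power (twice_dot u w) = - 1"
    by (cases "twice_dot u w" rule: exhaust_Z4) auto
  have "exp_sum UNIV (\<lambda>v. twice_dot v w) = exp_sum UNIV (\<lambda>v. twice_dot (v + u) w)"
    unfolding exp_sum_def by (rule sum_translate[symmetric])
  also have "\<dots> = - exp_sum UNIV (\<lambda>v. twice_dot v w)"
    by (simp add: twice_dot_add_left exp_sum_add_const minus)
  finally show ?thesis using False by simp
qed

definition kword :: "'m::{finite,linorder} bmat \<Rightarrow> 'm bvec \<Rightarrow> 4 \<Rightarrow> 'm bvec \<Rightarrow> 4"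
  where "kword R s \<epsilon> v = quad_form R v + twice_dot s v + \<epsilon>"

lemma kerdock_words_eq: "kerdock_words S = {kword R s \<epsilon> | R s \<epsilon>. R \<in> S}"
  by (simp add: kerdock_words_def kword_def[abs_def] twice_dot_def)

lemma kword_add:
  assumes "symmetric_matrix R"
  shows "kword R s \<epsilon> (u + v) = kword R s \<epsilon> u + kword R s 0 v + twice_dot u (R *v v)"
  by (simp add: kword_def quad_form_add[OF assms] twice_dot_add_right)

lemma kword_zero_matrix: "kword 0 s \<epsilon> = (\<lambda>v. twice_dot s v + \<epsilon>)"
  by (simp add: kword_def[abs_def])

lemma twice_kword: "2 * kword R s \<epsilon> v = twice_dot v (diag_vec R) + 2 * \<epsilon>"
  by (simp add: kword_def distrib_left twice_quad_form twice_dot_commute)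

lemma exp_sum_twice_kword:
  assumes "diag_vec R \<noteq> 0"
  shows "exp_sum UNIV (\<lambda>v. 2 * kword R s \<epsilon> v) = 0"
  using assms by (simp add: twice_kword exp_sum_add_const exp_sum_twice_dot)

lemma invertible_mult_vec_eq_0_iff:
  fixes R :: "'a::field^'n^'n"
  assumes "invertible R"
  shows "R *v w = 0 \<longleftrightarrow> w = 0"
proof
  assume "R *v w = 0"
  with assms show "w = 0" using matrix_left_invertible_ker[of R] unfolding invertible_def by blast
qed simp

lemma exp_sum_kword_norm:
  fixes R :: "'m::{finite,linorder} bmat"
  assumes sym: "symmetric_matrix R" and inv: "invertible R"
  shows "exp_sum UNIV (kword R s \<epsilon>) * cnj (exp_sum UNIV (kword R s \<epsilon>)) = 2 ^ CARD('m)"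
proof -
  let ?x = "kword R s \<epsilon>" and ?y = "kword R s 0"
  have difference: "?x (w + v) - ?x v = ?y w + twice_dot v (R *v w)" for v w
    unfolding add.commute[of w v] kword_add[OF sym] by simp
  have "exp_sum UNIV ?x * cnj (exp_sum UNIV ?x) = (\<Sum>v\<in>UNIV. \<Sum>u\<in>UNIV. i_power (?x u - ?x v))"
    unfolding exp_sum_def cnj_sum sum_product by (subst sum.swap) (simp add: i_power_diff)
  also have "\<dots> = (\<Sum>v\<in>UNIV. \<Sum>w\<in>UNIV. i_power (?x (w + v) - ?x v))"
    by (simp only: sum_translate[of "\<lambda>u. i_power (?x u - _)"])
  also have "\<dots> = (\<Sum>v\<in>UNIV. \<Sum>w\<in>UNIV. i_power (?y w) * i_power (twice_dot v (R *v w)))"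
    by (simp only: difference i_power_add)
  also have "\<dots> = (\<Sum>w\<in>UNIV. i_power (?y w) * exp_sum UNIV (\<lambda>v. twice_dot v (R *v w)))"
    by (subst sum.swap) (simp add: exp_sum_def sum_distrib_left)
  also have "\<dots> = (\<Sum>w\<in>(UNIV :: 'm bvec set). if w = 0 then 2 ^ CARD('m) else 0)"
    by (intro sum.cong refl)
      (auto simp: exp_sum_twice_dot invertible_mult_vec_eq_0_iff[OF inv] kword_def)
  also have "\<dots> = 2 ^ CARD('m)" by simp
  finally show ?thesis .
qed

text \<open>
  A form with zero diagonal is even, so its exponential sum is a rational integer; but the square
  of its modulus is an odd power of 2.
\<close>

lemma diag_vec_nonzero:
  fixes R :: "'m::{finite,linorder} bmat"
  assumes sym: "symmetric_matrix R" and inv: "invertible R" and odd: "odd CARD('m)"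
  shows "diag_vec R \<noteq> 0"
proof
  assume "diag_vec R = 0"
  then have "2 * kword R 0 0 v = 0" for v by (simp add: twice_kword)
  moreover have "Im (i_power c) = 0" if "2 * c = 0" for c
    using that by (cases c rule: exhaust_Z4) auto
  ultimately have "Im (exp_sum UNIV (kword R 0 0)) = 0" by (simp add: exp_sum_def)
  with exp_sum_Re_Im_squared(2)[OF exp_sum_kword_norm[OF sym inv] odd, of 0 0] show False by simp
qed

section \<open>Additive codes over the integers modulo 4\<close>

lemma comm_group_Z4: "comm_group Z4"
proof (rule comm_groupI)
  show "\<exists>y\<in>carrier Z4. y \<otimes>\<^bsub>Z4\<^esub> x = \<one>\<^bsub>Z4\<^esub>" for x
    by (intro bexI[of _ "- x"]) (simp_all add: Z4_def)
qed (simp_all add: Z4_def add.assoc add.commute)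

lemma carrier_word_group: "carrier (word_group I) = extensional I"
  by (auto simp: word_group_def Z4_def PiE_def)

lemma mult_word_group: "x \<otimes>\<^bsub>word_group I\<^esub> y = (\<lambda>j\<in>I. x j + y j)"
  by (simp add: word_group_def Z4_def)

lemma one_word_group: "\<one>\<^bsub>word_group I\<^esub> = (\<lambda>j\<in>I. 0)"
  by (simp add: word_group_def Z4_def)

lemma comm_group_word_group: "comm_group (word_group I)"
  unfolding word_group_def
proof (rule group.group_comm_groupI)
  show "group (product_group I (\<lambda>_. Z4))"
    using comm_group_Z4 by (simp add: comm_group.axioms(2))
qed (simp add: Z4_def add.commute)

lemma inv_word_group:
  assumes "x \<in> extensional I"
  shows "inv\<^bsub>word_group I\<^esub> x = (\<lambda>j\<in>I. - x j)"
proof -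
  interpret comm_group "word_group I" by (rule comm_group_word_group)
  show ?thesis
    using assms
    by (intro inv_equality)
      (auto simp: carrier_word_group mult_word_group one_word_group fun_eq_iff)
qed

lemma finite_carrier_word_group:
  assumes "finite I"
  shows "finite (carrier (word_group I))"
proof -
  have "carrier (word_group I) = I \<rightarrow>\<^sub>E UNIV" by (simp add: carrier_word_group PiE_def)
  with assms show ?thesis by (simp add: finite_PiE)
qed

lemma unit_word_in_word_group: "unit_word I k \<in> carrier (word_group I)"
  by (simp add: carrier_word_group unit_word_def)

lemma unit_word_outside: "k \<notin> I \<Longrightarrow> unit_word I k = \<one>\<^bsub>word_group I\<^esub>"
  by (auto simp: unit_word_def one_word_group fun_eq_iff)

lemma dot_product_mult_left:
  "dot_product I (x \<otimes>\<^bsub>word_group I\<^esub> y) z = dot_product I x z + dot_product I y z"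
  by (simp add: dot_product_def mult_word_group distrib_right sum.distrib)

lemma dot_product_mult_right:
  "dot_product I x (y \<otimes>\<^bsub>word_group I\<^esub> z) = dot_product I x y + dot_product I x z"
  by (simp add: dot_product_def mult_word_group distrib_left sum.distrib)

lemma dot_product_inv_right:
  "y \<in> carrier (word_group I) \<Longrightarrow> dot_product I x (inv\<^bsub>word_group I\<^esub> y) = - dot_product I x y"
  by (simp add: dot_product_def carrier_word_group inv_word_group sum_negf)

lemma dot_product_one_right: "dot_product I x \<one>\<^bsub>word_group I\<^esub> = 0"
  by (simp add: dot_product_def one_word_group)

lemma dot_product_unit_word:
  assumes "finite I"
  shows "dot_product I x (unit_word I k) = (if k \<in> I then x k else 0)"
proof -
  have "dot_product I x (unit_word I k) = (\<Sum>j\<in>I. if j = k then x j else 0)"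
    unfolding dot_product_def unit_word_def by (intro sum.cong refl) auto
  with assms show ?thesis by simp
qed

lemma dual_code_iff:
  "y \<in> dual_code I K \<longleftrightarrow> y \<in> carrier (word_group I) \<and> (\<forall>x\<in>K. dot_product I x y = 0)"
  by (simp add: dual_code_def)

lemma subgroup_dual_code: "subgroup (dual_code I K) (word_group I)"
proof -
  interpret comm_group "word_group I" by (rule comm_group_word_group)
  show ?thesis
  proof (rule subgroupI)
    have "\<one>\<^bsub>word_group I\<^esub> \<in> dual_code I K" by (simp add: dual_code_iff dot_product_one_right)
    then show "dual_code I K \<noteq> {}" by blast
  qed (auto simp: dual_code_iff dot_product_inv_right dot_product_mult_right)
qed

lemma shorten_iff: "x \<in> shorten I i K \<longleftrightarrow> (\<exists>y\<in>K. y i = 0 \<and> x = restrict y (I - {i}))"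
  by (auto simp: shorten_def)

lemma subgroup_shorten:
  assumes K: "subgroup K (word_group I)" and i: "i \<in> I"
  shows "subgroup (shorten I i K) (word_group (I - {i}))"
proof -
  interpret A: comm_group "word_group I" by (rule comm_group_word_group)
  interpret B: comm_group "word_group (I - {i})" by (rule comm_group_word_group)
  have ext: "y \<in> extensional I" if "y \<in> K" for y
    using subgroup.subset[OF K] that by (auto simp: carrier_word_group)
  show ?thesis
  proof (rule B.subgroupI)
    show "shorten I i K \<subseteq> carrier (word_group (I - {i}))"
      by (auto simp: shorten_iff carrier_word_group)
    show "shorten I i K \<noteq> {}"
      using subgroup.one_closed[OF K] i by (auto simp: shorten_def one_word_group)
  next
    fix x assume "x \<in> shorten I i K"
    then obtain y where y: "y \<in> K" "y i = 0" "x = restrict y (I - {i})" by (auto simp: shorten_iff)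
    have "inv\<^bsub>word_group (I - {i})\<^esub> x = restrict (inv\<^bsub>word_group I\<^esub> y) (I - {i})"
      using ext[OF y(1)] by (auto simp: y(3) inv_word_group fun_eq_iff)
    moreover have "inv\<^bsub>word_group I\<^esub> y \<in> K" "(inv\<^bsub>word_group I\<^esub> y) i = 0"
      using subgroup.m_inv_closed[OF K y(1)] ext[OF y(1)] y(2) i by (simp_all add: inv_word_group)
    ultimately show "inv\<^bsub>word_group (I - {i})\<^esub> x \<in> shorten I i K" unfolding shorten_iff by blast
  next
    fix x x' assume "x \<in> shorten I i K" "x' \<in> shorten I i K"
    then obtain y y' where y: "y \<in> K" "y i = 0" "x = restrict y (I - {i})"
      and y': "y' \<in> K" "y' i = 0" "x' = restrict y' (I - {i})"
      by (auto simp: shorten_iff)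
    have "x \<otimes>\<^bsub>word_group (I - {i})\<^esub> x' = restrict (y \<otimes>\<^bsub>word_group I\<^esub> y') (I - {i})"
      by (auto simp: y(3) y'(3) mult_word_group fun_eq_iff)
    moreover have "y \<otimes>\<^bsub>word_group I\<^esub> y' \<in> K" "(y \<otimes>\<^bsub>word_group I\<^esub> y') i = 0"
      using subgroup.m_closed[OF K y(1) y'(1)] y(2) y'(2) i by (simp_all add: mult_word_group)
    ultimately show "x \<otimes>\<^bsub>word_group (I - {i})\<^esub> x' \<in> shorten I i K" unfolding shorten_iff by blast
  qed
qed

lemma additive_code_scale_closed:
  assumes K: "subgroup K (word_group I)" and w: "w \<in> K"
  shows "(\<lambda>v\<in>I. c * w v) \<in> K"
proof -
  have ext: "w \<in> extensional I" using subgroup.subset[OF K] w by (auto simp: carrier_word_group)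
  have minus: "3 * a = - a" for a :: 4 by (cases a rule: exhaust_Z4) simp_all
  show ?thesis
  proof (cases c rule: exhaust_Z4)
    case zero
    then show ?thesis using subgroup.one_closed[OF K] by (simp add: one_word_group)
  next
    case one
    then show ?thesis using w ext by (simp add: extensional_restrict)
  next
    case two
    then show ?thesis using subgroup.m_closed[OF K w w] by (simp only: mult_word_group mult_2)
  next
    case three
    then show ?thesis
      using subgroup.m_inv_closed[OF K w] by (simp only: inv_word_group[OF ext] minus)
  qed
qed

text \<open>Subtracting a multiple of \<open>w\<close> moves any codeword into the part that vanishes at \<open>i\<close>.\<close>

lemma dual_code_shorten:
  assumes K: "subgroup K (word_group I)" and I: "finite I" "i \<in> I" and w: "w \<in> K" "w i = 1"
  shows "dual_code (I - {i}) (shorten I i K) = puncture I i (dual_code I K)"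
proof (intro equalityI subsetI)
  let ?J = "I - {i}"
  fix y assume y: "y \<in> dual_code ?J (shorten I i K)"
  define z where "z = (\<lambda>v\<in>I. if v = i then - dot_product ?J w y else y v)"
  have "dot_product I x z = 0" if x: "x \<in> K" for x
  proof -
    define u where "u = x \<otimes>\<^bsub>word_group I\<^esub> (\<lambda>v\<in>I. - x i * w v)"
    have "u \<in> K"
      unfolding u_def using K x additive_code_scale_closed[OF K w(1)] by (rule subgroup.m_closed)
    moreover have "u i = 0" using I(2) w(2) by (simp add: u_def mult_word_group)
    ultimately have "restrict u ?J \<in> shorten I i K" unfolding shorten_iff by blast
    then have "dot_product ?J (restrict u ?J) y = 0" using y by (simp add: dual_code_iff)
    moreover have "dot_product ?J (restrict u ?J) y = dot_product ?J x y - x i * dot_product ?J w y"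
      by (simp add: dot_product_def u_def mult_word_group left_diff_distrib sum_subtractf
          sum_distrib_left mult.assoc)
    moreover have "dot_product I x z = dot_product ?J x y - x i * dot_product ?J w y"
      using I by (simp add: dot_product_def z_def sum.remove)
    ultimately show ?thesis by simp
  qed
  then have "z \<in> dual_code I K" by (simp add: dual_code_iff carrier_word_group z_def)
  moreover have "y = restrict z ?J"
    using y by (intro extensionalityI[of _ ?J]) (auto simp: z_def dual_code_iff carrier_word_group)
  ultimately show "y \<in> puncture I i (dual_code I K)" by (auto simp: puncture_def)
next
  fix y assume "y \<in> puncture I i (dual_code I K)"
  then obtain z where z: "z \<in> dual_code I K" "y = restrict z (I - {i})" by (auto simp: puncture_def)
  have "dot_product (I - {i}) (restrict x (I - {i})) y = dot_product I x z" if "x i = 0" for x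
    using I that by (simp add: dot_product_def z(2) sum.remove)
  with z show "y \<in> dual_code (I - {i}) (shorten I i K)"
    by (auto simp: dual_code_iff shorten_iff carrier_word_group)
qed

locale additive_code =
  fixes I :: "'v set" and K :: "('v \<Rightarrow> 4) set"
  assumes finite_I: "finite I" and subgroup_K: "subgroup K (word_group I)"
begin

abbreviation A :: "('v \<Rightarrow> 4) monoid" where "A \<equiv> word_group I"
abbreviation C :: "('v \<Rightarrow> 4) set" where "C \<equiv> dual_code I K"
abbreviation G :: "('v \<Rightarrow> 4) monoid" where "G \<equiv> A\<lparr>carrier := K\<rparr>"
abbreviation H :: "('v \<Rightarrow> 4) set monoid" where "H \<equiv> A Mod C"

sublocale A: comm_group A
  by (rule comm_group_word_group)

sublocale C: normal C A
  using subgroup_dual_code by (rule A.subgroup_imp_normal)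

lemma K_closed: "x \<in> K \<Longrightarrow> x \<in> carrier A"
  using subgroup.subset[OF subgroup_K] by blast

sublocale G: finite_comm_group G
proof (intro finite_comm_group.intro finite_comm_group_axioms.intro group.group_comm_groupI)
  show "group G" by (rule A.subgroup_imp_group[OF subgroup_K])
  show "finite (carrier G)"
    using finite_subset[OF subgroup.subset[OF subgroup_K]] finite_carrier_word_group[OF finite_I]
    by simp
qed (simp add: A.m_comm K_closed)

sublocale H: finite_comm_group H
proof (intro finite_comm_group.intro finite_comm_group_axioms.intro)
  show "comm_group H" using subgroup_dual_code by (rule A.abelian_FactGroup)
  show "finite (carrier H)" by (simp add: carrier_FactGroup finite_carrier_word_group[OF finite_I])
qed

lemma H_cases:
  assumes "Y \<in> carrier H"
  obtains a where "a \<in> carrier A" "Y = C #>\<^bsub>A\<^esub> a"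
  using assms by (auto simp: carrier_FactGroup)

lemma coset_in_H: "a \<in> carrier A \<Longrightarrow> C #>\<^bsub>A\<^esub> a \<in> carrier H"
  by (auto simp: carrier_FactGroup)

lemma dot_product_coset:
  assumes "x \<in> K" "y \<in> C #>\<^bsub>A\<^esub> a"
  shows "dot_product I x y = dot_product I x a"
  using assms by (auto simp: r_coset_def dual_code_iff dot_product_mult_right)

lemma coset_pairing_eq:
  assumes "x \<in> K" "a \<in> carrier A"
  shows "coset_pairing I x (C #>\<^bsub>A\<^esub> a) = dot_product I x a"
proof -
  have "dot_product I x ` (C #>\<^bsub>A\<^esub> a) = {dot_product I x a}"
    using dot_product_coset[OF assms(1)] A.rcos_self[OF assms(2) subgroup_dual_code] by blast
  then show ?thesis by (simp add: coset_pairing_def)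
qed

lemma coset_pairing_well_defined:
  assumes "x \<in> K" "Y \<in> carrier H" "y \<in> Y"
  shows "coset_pairing I x Y = dot_product I x y"
  using assms by (auto elim!: H_cases simp: coset_pairing_eq dot_product_coset)

lemma coset_pairing_mult_left:
  assumes "x \<in> K" "y \<in> K" "Y \<in> carrier H"
  shows "coset_pairing I (x \<otimes>\<^bsub>A\<^esub> y) Y = coset_pairing I x Y + coset_pairing I y Y"
  using assms subgroup.m_closed[OF subgroup_K assms(1,2)]
  by (auto elim!: H_cases simp: coset_pairing_eq dot_product_mult_left)

lemma coset_pairing_mult_right:
  assumes x: "x \<in> K" and "Y \<in> carrier H" "Z \<in> carrier H"
  shows "coset_pairing I x (Y \<otimes>\<^bsub>H\<^esub> Z) = coset_pairing I x Y + coset_pairing I x Z"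
proof -
  obtain a b where ab: "a \<in> carrier A" "Y = C #>\<^bsub>A\<^esub> a" "b \<in> carrier A" "Z = C #>\<^bsub>A\<^esub> b"
    using assms(2,3) by (metis H_cases)
  then have "Y \<otimes>\<^bsub>H\<^esub> Z = C #>\<^bsub>A\<^esub> (a \<otimes>\<^bsub>A\<^esub> b)" by (simp add: C.rcos_sum)
  with x ab show ?thesis by (simp add: coset_pairing_eq dot_product_mult_right)
qed

lemma coset_pairing_left_nondegenerate:
  assumes x: "x \<in> K" and zero: "\<And>Y. Y \<in> carrier H \<Longrightarrow> coset_pairing I x Y = 0"
  shows "x = \<one>\<^bsub>A\<^esub>"
proof (rule extensionalityI)
  show "x \<in> extensional I" using K_closed[OF x] by (simp add: carrier_word_group)
  show "x k = \<one>\<^bsub>A\<^esub> k" if "k \<in> I" for k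
    using zero[OF coset_in_H[OF unit_word_in_word_group[of I k]]] x that
    by (simp add: coset_pairing_eq unit_word_in_word_group dot_product_unit_word[OF finite_I]
        one_word_group)
qed (simp add: one_word_group)

lemma coset_pairing_right_nondegenerate:
  assumes Y: "Y \<in> carrier H" and zero: "\<And>x. x \<in> K \<Longrightarrow> coset_pairing I x Y = 0"
  shows "Y = \<one>\<^bsub>H\<^esub>"
proof -
  obtain a where a: "a \<in> carrier A" "Y = C #>\<^bsub>A\<^esub> a" using Y by (rule H_cases)
  then have "a \<in> C" using zero by (simp add: dual_code_iff coset_pairing_eq)
  then show ?thesis using A.coset_join2[OF a(1) subgroup_dual_code] a by simp
qed

lemma nondegenerate_coset_pairing: "nondegenerate_pairing G H (coset_pairing I)"
  using coset_pairing_left_nondegenerate coset_pairing_right_nondegenerate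
  by (auto simp: nondegenerate_pairing_def hom_def Z4_def coset_pairing_mult_left
      coset_pairing_mult_right simp del: mult_FactGroup one_FactGroup)

sublocale bicharacter G H "\<lambda>x Y. i_power (coset_pairing I x Y)"
proof unfold_locales
  show "x = \<one>\<^bsub>G\<^esub>" if "x \<in> carrier G" "\<And>Y. Y \<in> carrier H \<Longrightarrow> i_power (coset_pairing I x Y) = 1" for x
    using that coset_pairing_left_nondegenerate[of x] by (simp add: i_power_eq_1_iff)
  show "Y = \<one>\<^bsub>H\<^esub>" if "Y \<in> carrier H" "\<And>x. x \<in> carrier G \<Longrightarrow> i_power (coset_pairing I x Y) = 1" for Y
    using that coset_pairing_right_nondegenerate[of Y] by (simp add: i_power_eq_1_iff)
qed (simp_all add: coset_pairing_mult_left coset_pairing_mult_right i_power_add del: mult_FactGroup)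

lemma right_character_eq: "pairing_character G (coset_pairing I) = right_character"
  by (simp add: fun_eq_iff pairing_character_def right_character_def)

end

section \<open>Linear Kerdock codes\<close>

locale linear_kerdock =
  fixes S :: "'m::{finite,linorder} bmat set"
  assumes kerdock_set: "kerdock_set S"
    and subgroup_kerdock_words: "subgroup (kerdock_words S) (word_group UNIV)"
    and odd_m: "odd CARD('m)"
begin

abbreviation kerdock :: "('m bvec \<Rightarrow> 4) set"
  where "kerdock \<equiv> kerdock_words S"

lemma kerdock_cases:
  assumes "x \<in> kerdock"
  obtains R s \<epsilon> where "R \<in> S" "x = kword R s \<epsilon>"
  using assms by (auto simp: kerdock_words_eq)

lemma kword_in_kerdock: "R \<in> S \<Longrightarrow> kword R s \<epsilon> \<in> kerdock"
  by (auto simp: kerdock_words_eq)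

lemma kerdock_add: "x \<in> kerdock \<Longrightarrow> y \<in> kerdock \<Longrightarrow> (\<lambda>v. x v + y v) \<in> kerdock"
  using subgroup.m_closed[OF subgroup_kerdock_words, of x y]
  by (simp add: mult_word_group restrict_def)

lemma kerdock_uminus: "x \<in> kerdock \<Longrightarrow> (\<lambda>v. - x v) \<in> kerdock"
  using subgroup.m_inv_closed[OF subgroup_kerdock_words, of x]
  by (simp add: inv_word_group restrict_def)

lemma symmetric_S: "R \<in> S \<Longrightarrow> symmetric_matrix R"
  using kerdock_set by (simp add: kerdock_set_def)

lemma symmetric_diff_S: "R \<in> S \<Longrightarrow> R' \<in> S \<Longrightarrow> symmetric_matrix (R - R')"
  using symmetric_S[of R] symmetric_S[of R'] by (simp add: transpose_def vec_eq_iff)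

lemma invertible_diff_S: "R \<in> S \<Longrightarrow> R' \<in> S \<Longrightarrow> R \<noteq> R' \<Longrightarrow> invertible (R - R')"
  using kerdock_set by (simp add: kerdock_set_def)

lemma card_S: "card S = CARD('m bvec)"
  using kerdock_set by (simp add: kerdock_set_def CARD_bit)

lemma zero_in_S: "0 \<in> S"
proof -
  have "(\<lambda>v. 0) \<in> kerdock"
    using subgroup.one_closed[OF subgroup_kerdock_words] by (simp add: one_word_group restrict_def)
  then obtain R s \<epsilon> where R: "R \<in> S" and zero: "(\<lambda>v. 0) = kword R s \<epsilon>"
    by (rule kerdock_cases)
  have vanish: "kword R s \<epsilon> v = 0" for v using fun_cong[OF zero, of v] by simp
  have "twice_dot u (R *v v) = 0" for u v
    using kword_add[OF symmetric_S[OF R], of s \<epsilon> u v] kword_add[OF symmetric_S[OF R], of s \<epsilon> 0 v]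
    by (simp add: vanish)
  then have "R *v v = 0" for v by (rule twice_dot_eq_0D)
  then have "R = 0" by (simp add: matrix_eq)
  with R show ?thesis by simp
qed

lemma invertible_S: "R \<in> S \<Longrightarrow> R \<noteq> 0 \<Longrightarrow> invertible R"
  using invertible_diff_S[OF _ zero_in_S] by simp

lemma twice_dot_in_kerdock: "twice_dot s \<in> kerdock"
  using kword_in_kerdock[OF zero_in_S, of s 0] by (simp add: kword_zero_matrix)

lemma const_in_kerdock: "(\<lambda>v. c) \<in> kerdock"
  using kword_in_kerdock[OF zero_in_S, of 0 c] by (simp add: kword_zero_matrix)

lemma image_S_eq_UNIV:
  fixes f :: "_ \<Rightarrow> 'm bvec"
  assumes "inj_on f S"
  shows "f ` S = UNIV"
  using card_image[OF assms] card_S by (intro card_subset_eq) auto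

lemma S_mult_vec_surj:
  assumes "w \<noteq> 0"
  shows "(\<lambda>R. R *v w) ` S = UNIV"
proof (rule image_S_eq_UNIV, rule inj_onI, rule ccontr)
  fix R R' assume R: "R \<in> S" "R' \<in> S" "R *v w = R' *v w" "R \<noteq> R'"
  have "(R - R') *v w = R *v w - R' *v w"
    by (simp add: matrix_vector_mult_def vec_eq_iff left_diff_distrib sum_subtractf)
  with assms R(3) invertible_mult_vec_eq_0_iff[OF invertible_diff_S[OF R(1,2,4)], of w] show False
    by simp
qed

lemma S_diag_vec_surj: "diag_vec ` S = UNIV"
proof (rule image_S_eq_UNIV, rule inj_onI, rule ccontr)
  fix R R' assume R: "R \<in> S" "R' \<in> S" "diag_vec R = diag_vec R'" "R \<noteq> R'"
  then have "diag_vec (R - R') = 0" by (simp add: diag_vec_diff)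
  with diag_vec_nonzero[OF symmetric_diff_S[OF R(1,2)] invertible_diff_S[OF R(1,2,4)] odd_m]
  show False by simp
qed

lemma kerdock_diff_eq_twice_diffD:
  assumes "\<And>x. x \<in> kerdock \<Longrightarrow> x j - x k = 2 * x l - 2 * x i"
  shows "j = k"
proof (rule twice_dot_eqD)
  show "twice_dot s j = twice_dot s k" for s
    using assms[OF twice_dot_in_kerdock[of s]] by simp
qed

lemma kerdock_twice_eqD:
  assumes "\<And>x. x \<in> kerdock \<Longrightarrow> 2 * x k = 2 * x l"
  shows "k = l"
proof (rule twice_dot_eqD)
  fix d
  obtain R where R: "R \<in> S" "d = diag_vec R" using S_diag_vec_surj by blast
  show "twice_dot d k = twice_dot d l"
    using assms[OF kword_in_kerdock[OF R(1), of 0 0]]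
    by (simp add: R(2) twice_kword twice_dot_commute)
qed

lemma kerdock_diff_eqD:
  assumes eq: "\<And>x. x \<in> kerdock \<Longrightarrow> x j - x k = x j' - x k'" and "j \<noteq> k"
  shows "j = j' \<and> k = k'"
proof -
  define w where "w = j - k"
  have "w \<noteq> 0" using \<open>j \<noteq> k\<close> by (simp add: w_def)
  have "w = j' - k'"
  proof (rule twice_dot_eqD)
    show "twice_dot s w = twice_dot s (j' - k')" for s
      using eq[OF twice_dot_in_kerdock[of s]] by (simp add: w_def twice_dot_diff_right)
  qed
  then have j: "j = k + w" and j': "j' = k' + w" by (simp_all add: w_def algebra_simps)
  have "k = k'"
  proof (rule twice_dot_eqD)
    fix r
    obtain R where R: "R \<in> S" "r = R *v w" using S_mult_vec_surj[OF \<open>w \<noteq> 0\<close>] by blast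
    show "twice_dot r k = twice_dot r k'"
      using eq[OF kword_in_kerdock[OF R(1), of 0 0]]
      by (simp add: j j' R(2) kword_add[OF symmetric_S[OF R(1)]] twice_dot_commute)
  qed
  with j j' show ?thesis by simp
qed

lemma kerdock_word_types:
  assumes x: "x \<in> kerdock" and i: "x i = 0"
  obtains (zero) "x = (\<lambda>v. 0)"
  | (nonlinear) "(Re (exp_sum UNIV x))\<^sup>2 = 2 ^ (CARD('m) - 1)"
      "exp_sum UNIV x * cnj (exp_sum UNIV x) = 2 ^ CARD('m)" "exp_sum UNIV (\<lambda>v. 2 * x v) = 0"
  | (linear) "exp_sum UNIV x = 0" "exp_sum UNIV (\<lambda>v. 2 * x v) = 2 ^ CARD('m)"
proof -
  obtain R s \<epsilon> where R: "R \<in> S" and x_eq: "x = kword R s \<epsilon>" using kerdock_cases[OF x] .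
  consider "R \<noteq> 0" | "R = 0" "s \<noteq> 0" | "R = 0" "s = 0" by blast
  then show ?thesis
  proof cases
    assume "R \<noteq> 0"
    then have inv: "invertible R" and sym: "symmetric_matrix R"
      using R by (auto intro: invertible_S symmetric_S)
    note norm = exp_sum_kword_norm[OF sym inv, of s \<epsilon>]
    show ?thesis
      using exp_sum_Re_Im_squared(1)[OF norm odd_m] norm
        exp_sum_twice_kword[OF diag_vec_nonzero[OF sym inv odd_m], of s \<epsilon>]
      unfolding x_eq[symmetric] by (rule nonlinear)
  next
    assume R_s: "R = 0" "s \<noteq> 0"
    have W: "exp_sum UNIV x = 0"
      by (simp add: x_eq R_s kword_zero_matrix exp_sum_add_const exp_sum_twice_dot
          twice_dot_commute[of s])
    have "2 * x v = 2 * \<epsilon>" for v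
      by (simp add: x_eq R_s kword_zero_matrix distrib_left)
    then have "2 * x v = 0" for v using i by (metis mult_zero_right)
    then have "exp_sum UNIV (\<lambda>v. 2 * x v) = 2 ^ CARD('m)"
      by (simp add: exp_sum_const CARD_bit)
    with W show ?thesis by (rule linear)
  next
    assume "R = 0" "s = 0"
    then have "x = (\<lambda>v. \<epsilon>)" by (simp add: x_eq kword_zero_matrix)
    then have "x = (\<lambda>v. 0)" using i by simp
    then show ?thesis by (rule zero)
  qed
qed

end

section \<open>Shortened Kerdock codes\<close>

lemma atMost_3: "{..3::nat} = {0, 1, 2, 3}"
  by auto

lemma le_3_cases:
  fixes j :: nat
  assumes "j \<le> 3"
  obtains (zero) "j = 0" | (one) "j = 1" | (two) "j = 2" | (three) "j = 3"
  using assms by linarith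

locale shortened_kerdock = linear_kerdock S
  for S :: "'m::{finite,linorder} bmat set" +
  fixes i :: "'m bvec"
begin

abbreviation I :: "'m bvec set" where "I \<equiv> UNIV - {i}"
abbreviation kshort :: "('m bvec \<Rightarrow> 4) set" where "kshort \<equiv> shorten UNIV i kerdock"

sublocale additive_code I kshort
  by (intro additive_code.intro subgroup_shorten[OF subgroup_kerdock_words UNIV_I]) simp

lemma dual_code_kshort: "C = puncture UNIV i (dual_code UNIV kerdock)"
  using const_in_kerdock[of 1] by (intro dual_code_shorten[OF subgroup_kerdock_words]) auto

lemma restrict_in_kshort: "x \<in> kerdock \<Longrightarrow> x i = 0 \<Longrightarrow> restrict x I \<in> kshort"
  by (auto simp: shorten_iff)

lemma kshort_cases:
  assumes "x \<in> kshort"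
  obtains y where "y \<in> kerdock" "y i = 0" "x = restrict y I"
  using assms by (auto simp: shorten_iff)

lemma kerdock_normalize: "x \<in> kerdock \<Longrightarrow> (\<lambda>v. x v - x i) \<in> kerdock"
  using kerdock_add[OF _ const_in_kerdock[of "- x i"]] by simp

lemma card_I: "card I = 2 ^ CARD('m) - 1"
  by (simp add: card_Diff_singleton CARD_bit)

definition pair_coset :: "'m bvec \<times> 'm bvec \<Rightarrow> ('m bvec \<Rightarrow> 4) set"
  where "pair_coset = (\<lambda>(j, k). C #>\<^bsub>A\<^esub> (if j = k then unit_word I j \<otimes>\<^bsub>A\<^esub> unit_word I j
    else unit_word I j \<otimes>\<^bsub>A\<^esub> inv\<^bsub>A\<^esub> unit_word I k))"

lemma pair_coset_in_H: "pair_coset p \<in> carrier H"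
  by (cases p) (simp add: pair_coset_def coset_in_H unit_word_in_word_group)

lemma coset_pairing_pair_coset:
  assumes x: "x \<in> kerdock" "x i = 0"
  shows "coset_pairing I (restrict x I) (pair_coset (j, k)) =
    (if j = k then 2 * x j else x j - x k)"
proof -
  have "dot_product I (restrict x I) (unit_word I l) = x l" for l
    using x(2) by (simp add: dot_product_unit_word)
  then show ?thesis
    using restrict_in_kshort[OF x]
    by (simp add: pair_coset_def coset_pairing_eq unit_word_in_word_group dot_product_mult_right
        dot_product_inv_right del: restrict_apply)
qed

lemma inj_pair_coset: "inj pair_coset"
proof (rule injI)
  fix p p' assume eq: "pair_coset p = pair_coset p'"
  obtain j k j' k' where p: "p = (j, k)" "p' = (j', k')" by (metis surj_pair)
  have pairing_eq: "(if j = k then 2 * x j - 2 * x i else x j - x k) =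
      (if j' = k' then 2 * x j' - 2 * x i else x j' - x k')" if x: "x \<in> kerdock" for x
    using coset_pairing_pair_coset[OF kerdock_normalize[OF x], of j k]
      coset_pairing_pair_coset[OF kerdock_normalize[OF x], of j' k'] eq p
    by (simp add: right_diff_distrib split: if_splits)
  consider (differences) "j \<noteq> k" "j' \<noteq> k'" | (difference_twice) "j \<noteq> k" "j' = k'"
    | (twice_difference) "j = k" "j' \<noteq> k'" | (twices) "j = k" "j' = k'" by blast
  then show "p = p'"
  proof cases
    case differences
    then show ?thesis using kerdock_diff_eqD[of j k j' k'] pairing_eq p by auto
  next
    case difference_twice
    then show ?thesis using kerdock_diff_eq_twice_diffD[of j k j' i] pairing_eq by auto
  next
    case twice_difference
    then show ?thesis using kerdock_diff_eq_twice_diffD[of j' k' j i] pairing_eq[symmetric] by auto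
  next
    case twices
    then show ?thesis using kerdock_twice_eqD[of j j'] pairing_eq p by auto
  qed
qed

lemma card_kshort_le: "card kshort \<le> 4 ^ CARD('m)"
proof -
  let ?f = "\<lambda>(R, s). restrict (kword R s (- kword R s 0 i)) I"
  have "kshort \<subseteq> ?f ` (S \<times> UNIV)"
  proof
    fix x assume "x \<in> kshort"
    then obtain y where y: "y \<in> kerdock" "y i = 0" "x = restrict y I" by (rule kshort_cases)
    obtain R s \<epsilon> where R: "R \<in> S" "y = kword R s \<epsilon>" using kerdock_cases[OF y(1)] .
    have "\<epsilon> = - kword R s 0 i"
      using y(2) by (simp add: R(2) kword_def flip: eq_neg_iff_add_eq_0)
    with y R show "x \<in> ?f ` (S \<times> UNIV)" by (intro image_eqI[of _ _ "(R, s)"]) auto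
  qed
  then have "card kshort \<le> card (S \<times> (UNIV :: 'm bvec set))" by (rule surj_card_le[rotated]) simp
  also have "\<dots> = (2 * 2) ^ CARD('m)"
    unfolding card_cartesian_product card_S CARD_bvec power_mult_distrib ..
  finally show ?thesis by simp
qed

lemma card_range_pair_coset: "card (range pair_coset) = 4 ^ CARD('m)"
proof -
  have "card (range pair_coset) = CARD('m bvec \<times> 'm bvec)" by (rule card_image[OF inj_pair_coset])
  also have "\<dots> = (2 * 2) ^ CARD('m)" unfolding card_prod CARD_bvec power_mult_distrib ..
  finally show ?thesis by simp
qed

lemma range_pair_coset: "range pair_coset = carrier H"
proof (rule card_seteq)
  show "range pair_coset \<subseteq> carrier H" using pair_coset_in_H by auto
  show "card (carrier H) \<le> card (range pair_coset)"
    using card_kshort_le card_eq by (simp add: card_range_pair_coset)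
qed simp

lemma card_H: "card (carrier H) = 4 ^ CARD('m)"
  using card_range_pair_coset range_pair_coset by simp

lemma card_kshort: "card kshort = 4 ^ CARD('m)"
  using card_H card_eq by simp

section \<open>The classes of cosets\<close>

definition coset_class :: "nat \<Rightarrow> ('m bvec \<Rightarrow> 4) set set"
  where "coset_class j =
    [{C},
     {C #>\<^bsub>A\<^esub> unit_word I k | k. k \<in> I} \<union> {C #>\<^bsub>A\<^esub> inv\<^bsub>A\<^esub> unit_word I k | k. k \<in> I},
     {C #>\<^bsub>A\<^esub> (unit_word I k \<otimes>\<^bsub>A\<^esub> inv\<^bsub>A\<^esub> unit_word I l) | k l. k \<in> I \<and> l \<in> I \<and> k \<noteq> l},
     {C #>\<^bsub>A\<^esub> (unit_word I k \<otimes>\<^bsub>A\<^esub> unit_word I k) | k. k \<in> I}] ! j"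

definition pair_class :: "nat \<Rightarrow> ('m bvec \<times> 'm bvec) set"
  where "pair_class j =
    [{(i, i)}, (\<lambda>k. (k, i)) ` I \<union> (\<lambda>k. (i, k)) ` I, {(k, l). k \<in> I \<and> l \<in> I \<and> k \<noteq> l},
     (\<lambda>k. (k, k)) ` I] ! j"

lemma pair_coset_simps:
  "pair_coset (i, i) = C" "k \<noteq> i \<Longrightarrow> pair_coset (k, i) = C #>\<^bsub>A\<^esub> unit_word I k"
  "k \<noteq> i \<Longrightarrow> pair_coset (i, k) = C #>\<^bsub>A\<^esub> inv\<^bsub>A\<^esub> unit_word I k"
  "k \<noteq> l \<Longrightarrow> pair_coset (k, l) = C #>\<^bsub>A\<^esub> (unit_word I k \<otimes>\<^bsub>A\<^esub> inv\<^bsub>A\<^esub> unit_word I l)"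
  "pair_coset (k, k) = C #>\<^bsub>A\<^esub> (unit_word I k \<otimes>\<^bsub>A\<^esub> unit_word I k)"
  using unit_word_in_word_group[of I] C.subset
  by (simp_all add: pair_coset_def unit_word_outside[of i I] A.coset_mult_one)

lemma coset_class_eq:
  assumes "j \<le> 3"
  shows "coset_class j = pair_coset ` pair_class j"
proof -
  have image_I: "{f k | k. k \<in> I} = (\<lambda>k. pair_coset (p k)) ` I"
    if "\<And>k. k \<noteq> i \<Longrightarrow> pair_coset (p k) = f k" for f p
    unfolding setcompr_eq_image Collect_mem_eq using that by (intro image_cong) auto
  have plus: "{C #>\<^bsub>A\<^esub> unit_word I k | k. k \<in> I} = (\<lambda>k. pair_coset (k, i)) ` I"
    by (rule image_I) (rule pair_coset_simps(2))
  have minus: "{C #>\<^bsub>A\<^esub> inv\<^bsub>A\<^esub> unit_word I k | k. k \<in> I} = (\<lambda>k. pair_coset (i, k)) ` I"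
    by (rule image_I) (rule pair_coset_simps(3))
  have double: "{C #>\<^bsub>A\<^esub> (unit_word I k \<otimes>\<^bsub>A\<^esub> unit_word I k) | k. k \<in> I} =
      (\<lambda>k. pair_coset (k, k)) ` I"
    by (rule image_I) (rule pair_coset_simps(5))
  have difference: "{C #>\<^bsub>A\<^esub> (unit_word I k \<otimes>\<^bsub>A\<^esub> inv\<^bsub>A\<^esub> unit_word I l) | k l.
        k \<in> I \<and> l \<in> I \<and> k \<noteq> l} =
      pair_coset ` {(k, l). k \<in> I \<and> l \<in> I \<and> k \<noteq> l}"
    by (force simp: image_iff pair_coset_simps(4))
  have "map ((`) pair_coset) [{(i, i)}, (\<lambda>k. (k, i)) ` I \<union> (\<lambda>k. (i, k)) ` I,
      {(k, l). k \<in> I \<and> l \<in> I \<and> k \<noteq> l}, (\<lambda>k. (k, k)) ` I] ! j = coset_class j"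
    unfolding coset_class_def plus minus double difference
    by (simp only: list.map image_Un image_image image_insert image_empty pair_coset_simps(1))
  with assms show ?thesis unfolding pair_class_def by (subst (asm) nth_map) simp_all
qed

lemma pair_class_cover: "(\<Union>j\<le>3. pair_class j) = UNIV"
  unfolding atMost_3 by (auto simp: pair_class_def)

lemma pair_class_disjoint:
  assumes "j \<le> 3" "k \<le> 3" "j \<noteq> k"
  shows "pair_class j \<inter> pair_class k = {}"
  using assms(3)
  by (cases rule: le_3_cases[OF assms(1)]; cases rule: le_3_cases[OF assms(2)])
    (auto simp: pair_class_def)

lemma pair_class_swap: "j \<le> 3 \<Longrightarrow> (k, l) \<in> pair_class j \<Longrightarrow> (l, k) \<in> pair_class j"
  by (erule le_3_cases) (auto simp: pair_class_def)

lemma pair_class_nonempty: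
  assumes "CARD('m) \<ge> 3" "j \<le> 3"
  shows "pair_class j \<noteq> {}"
proof -
  have "(2::nat) ^ 3 \<le> 2 ^ CARD('m)" using assms(1) by (rule power_increasing) simp
  then have "\<not> card I \<le> 1" by (simp add: card_I)
  then obtain k l where "k \<in> I" "l \<in> I" "k \<noteq> l"
    by (metis card_le_Suc0_iff_eq finite One_nat_def)
  with assms(2) show ?thesis by (cases rule: le_3_cases) (auto simp: pair_class_def)
qed

lemma inv_pair_coset: "inv\<^bsub>H\<^esub> pair_coset (j, k) = pair_coset (k, j)"
proof (rule H.inv_equality)
  show "pair_coset (k, j) \<otimes>\<^bsub>H\<^esub> pair_coset (j, k) = \<one>\<^bsub>H\<^esub>"
  proof (rule coset_pairing_right_nondegenerate)
    fix x assume "x \<in> kshort"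
    then obtain y where y: "y \<in> kerdock" "y i = 0" "x = restrict y I" by (rule kshort_cases)
    have "2 * y j + 2 * y j = 0" using twice_twice_Z4[of "y j"] by (simp only: mult_2[of "2 * y j"])
    then show "coset_pairing I x (pair_coset (k, j) \<otimes>\<^bsub>H\<^esub> pair_coset (j, k)) = 0"
      unfolding y(3) coset_pairing_pair_coset[OF y(1,2)]
        coset_pairing_mult_right[OF restrict_in_kshort[OF y(1,2)] pair_coset_in_H pair_coset_in_H]
      by (cases "j = k") (simp_all only: if_True if_False, auto)
  qed (rule H.m_closed[OF pair_coset_in_H pair_coset_in_H])
qed (rule pair_coset_in_H)+

lemma symmetric_partition_coset_class: "symmetric_partition H 3 coset_class"
proof
  show "(\<Union>j\<le>3. coset_class j) = carrier H"
    by (simp add: coset_class_eq pair_class_cover range_pair_coset flip: image_UN)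
  show "coset_class j \<inter> coset_class k = {}" if "j \<le> 3" "k \<le> 3" "j \<noteq> k" for j k
    using that pair_class_disjoint[OF that]
    by (simp add: coset_class_eq flip: image_Int[OF inj_pair_coset])
  show "coset_class 0 = {\<one>\<^bsub>H\<^esub>}" by (simp add: coset_class_def)
  show "inv\<^bsub>H\<^esub> Y \<in> coset_class j" if "j \<le> 3" "Y \<in> coset_class j" for j Y
    using that by (auto simp: coset_class_eq inv_pair_coset dest: pair_class_swap)
qed

lemma sum_pair_class:
  assumes x: "x i = 0" and j: "j \<le> 3"
  shows "(\<Sum>(k, l)\<in>pair_class j. i_power (if k = l then 2 * x k else x k - x l)) =
    [1, exp_sum I x + cnj (exp_sum I x), exp_sum I x * cnj (exp_sum I x) - of_nat (card I),
     exp_sum I (\<lambda>v. 2 * x v)] ! j"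
  using j
proof (cases rule: le_3_cases)
  case zero
  then show ?thesis using x by (simp add: pair_class_def)
next
  case one
  have "(\<Sum>(k, l)\<in>pair_class 1. i_power (if k = l then 2 * x k else x k - x l)) =
      (\<Sum>k\<in>I. i_power (x k)) + (\<Sum>k\<in>I. i_power (- x k))"
    unfolding pair_class_def using x
    by (simp add: sum.union_disjoint sum.reindex inj_on_def disjoint_iff image_iff)
  with one show ?thesis by (simp add: exp_sum_def i_power_uminus)
next
  case two
  have "(\<Sum>(k, l)\<in>pair_class 2. i_power (if k = l then 2 * x k else x k - x l)) =
      (\<Sum>(k, l) | k \<in> I \<and> l \<in> I \<and> k \<noteq> l. i_power (x k - x l))"
    by (intro sum.cong) (auto simp: pair_class_def)
  also have "\<dots> = exp_sum I x * cnj (exp_sum I x) - of_nat (card I)"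
    by (rule sum_i_power_off_diagonal) simp
  finally show ?thesis using two by simp
next
  case three
  then show ?thesis by (simp add: pair_class_def sum.reindex inj_on_def exp_sum_def)
qed

lemma sum_coset_class_eq_sum_pair_class:
  assumes x: "x \<in> kerdock" "x i = 0" and j: "j \<le> 3"
  shows "(\<Sum>Y\<in>coset_class j. i_power (coset_pairing I (restrict x I) Y)) =
    (\<Sum>(k, l)\<in>pair_class j. i_power (if k = l then 2 * x k else x k - x l))"
  unfolding coset_class_eq[OF j] using inj_on_subset[OF inj_pair_coset]
  by (subst sum.reindex) (auto simp: coset_pairing_pair_coset[OF x] intro!: sum.cong)

lemma exp_sum_I: "x i = 0 \<Longrightarrow> exp_sum I x = exp_sum UNIV x - 1"
  using exp_sum_insert[of I i x] by (simp add: insert_UNIV insert_absorb)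

end

section \<open>The classes of codewords\<close>

lemma sqrt_four_square: "t \<ge> 0 \<Longrightarrow> sqrt (4 * t\<^sup>2) = 2 * t" for t :: real
  by (simp add: real_sqrt_mult)

lemma Q_matrix_mult_P_matrix:
  fixes t :: real
  assumes "t \<ge> 0" "j \<le> 3" "k \<le> 3"
  shows "(\<Sum>l\<le>3. Q_matrix (4 * t\<^sup>2) j l * P_matrix (4 * t\<^sup>2) l k) = (if j = k then 4 * t ^ 4 else 0)"
proof -
  have "j \<in> {0, 1, 2, 3}" "k \<in> {0, 1, 2, 3}" using assms atMost_3 by auto
  then show ?thesis
    unfolding atMost_3 Q_matrix_def P_matrix_def sqrt_four_square[OF assms(1)]
    by (elim insertE emptyE) (simp_all add: field_simps power2_eq_square power4_eq_xxxx)
qed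

text \<open>
  The values of $Re W$, $|W|^2$ and $\sum_v (-1)^{x_v}$ for the words \<open>x\<close> of the \<open>j\<close>-th class,
  where $W = \sum_v i^{x_v}$ and the length of the code is $2 t^2$.
\<close>

definition Re_value :: "real \<Rightarrow> nat \<Rightarrow> real"
  where "Re_value t j = [2 * t\<^sup>2, - t, t, 0] ! j"

definition norm_value :: "real \<Rightarrow> nat \<Rightarrow> real"
  where "norm_value t j = [4 * t ^ 4, 2 * t\<^sup>2, 2 * t\<^sup>2, 0] ! j"

definition twice_value :: "real \<Rightarrow> nat \<Rightarrow> real"
  where "twice_value t j = [2 * t\<^sup>2, 0, 0, 2 * t\<^sup>2] ! j"

lemmas exp_sum_values = Re_value_def norm_value_def twice_value_def

lemma Q_matrix_eq:
  assumes "t \<ge> 0" "j \<le> 3" "k \<le> 3"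
  shows "Q_matrix (4 * t\<^sup>2) j k =
    [1, 2 * (Re_value t j - 1), norm_value t j - 2 * Re_value t j + 2 - 2 * t\<^sup>2,
     twice_value t j - 1] ! k"
  unfolding Q_matrix_def sqrt_four_square[OF assms(1)] exp_sum_values
  by (cases rule: le_3_cases[OF assms(2)]; cases rule: le_3_cases[OF assms(3)])
    (simp_all add: field_simps power2_eq_square power4_eq_xxxx)

lemma Re_value_inj:
  assumes t: "t \<ge> 1" and jk: "j \<le> 3" "k \<le> 3" and eq: "Re_value t j = Re_value t k"
  shows "j = k"
proof -
  have "2 * t\<^sup>2 > t" using t by (simp add: power2_eq_square)
  then show ?thesis
    using t eq by (cases rule: le_3_cases[OF jk(1)]; cases rule: le_3_cases[OF jk(2)])
      (auto simp: Re_value_def)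
qed

context shortened_kerdock
begin

definition sqrt_half_length :: real
  where "sqrt_half_length = 2 ^ ((CARD('m) - 1) div 2)"

lemma sqrt_half_length_ge_1: "sqrt_half_length \<ge> 1"
  by (simp add: sqrt_half_length_def)

lemma sqrt_half_length_square: "sqrt_half_length\<^sup>2 = 2 ^ (CARD('m) - 1)"
proof -
  obtain k where "CARD('m) = 2 * k + 1" using odd_m by (elim oddE)
  then show ?thesis by (simp add: sqrt_half_length_def power_mult mult.commute)
qed

lemma twice_sqrt_half_length_square: "2 * sqrt_half_length\<^sup>2 = 2 ^ CARD('m)"
  unfolding sqrt_half_length_square by (simp flip: power_Suc)

definition weight_class :: "nat \<Rightarrow> ('m bvec \<Rightarrow> 4) set"
  where "weight_class j = {x \<in> kshort. lee_weight I x =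
    [0, 2 ^ CARD('m) + 2 ^ ((CARD('m) - 1) div 2), 2 ^ CARD('m) - 2 ^ ((CARD('m) - 1) div 2),
     2 ^ CARD('m)] ! j}"

lemma weight_class_iff:
  assumes x: "x \<in> kerdock" "x i = 0" and j: "j \<le> 3"
  shows "restrict x I \<in> weight_class j \<longleftrightarrow> Re (exp_sum UNIV x) = Re_value sqrt_half_length j"
proof -
  let ?w = "[0, 2 ^ CARD('m) + 2 ^ ((CARD('m) - 1) div 2),
     2 ^ CARD('m) - 2 ^ ((CARD('m) - 1) div 2),
     2 ^ CARD('m)] ! j :: nat"
  have sqrt_half_length_eq: "(2::real) ^ ((CARD('m) - Suc 0) div 2) = sqrt_half_length"
    by (simp add: sqrt_half_length_def)
  have "(2::nat) ^ ((CARD('m) - 1) div 2) \<le> 2 ^ CARD('m)" by (intro power_increasing) auto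
  then have "real ?w = 2 ^ CARD('m) - Re_value sqrt_half_length j"
    by (cases rule: le_3_cases[OF j])
      (simp_all add: Re_value_def of_nat_diff twice_sqrt_half_length_square sqrt_half_length_eq)
  moreover have "real (lee_weight I (restrict x I)) = 2 ^ CARD('m) - Re (exp_sum UNIV x)"
    using exp_sum_I[of x] x(2) exp_sum_cong[of I "restrict x I" x]
    by (simp add: lee_weight_eq_exp_sum card_I of_nat_diff)
  ultimately have "lee_weight I (restrict x I) = ?w \<longleftrightarrow>
      Re (exp_sum UNIV x) = Re_value sqrt_half_length j"
    by linarith
  then show ?thesis using restrict_in_kshort[OF x] unfolding weight_class_def by blast
qed

definition exp_sum_type :: "nat \<Rightarrow> ('m bvec \<Rightarrow> 4) \<Rightarrow> bool"
  where "exp_sum_type j x \<longleftrightarrow> Re (exp_sum UNIV x) = Re_value sqrt_half_length j \<and>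
    exp_sum UNIV x * cnj (exp_sum UNIV x) = of_real (norm_value sqrt_half_length j) \<and>
    exp_sum UNIV (\<lambda>v. 2 * x v) = of_real (twice_value sqrt_half_length j) \<and>
    (j = 0 \<longrightarrow> x = (\<lambda>v. 0))"

lemma two_power_m_eq: "(2::complex) ^ CARD('m) = of_real (2 * sqrt_half_length\<^sup>2)"
  by (simp only: twice_sqrt_half_length_square of_real_power of_real_numeral)

lemma exp_sum_type_zero: "exp_sum_type 0 (\<lambda>v. 0)"
  using two_power_m_eq
  by (simp add: exp_sum_type_def exp_sum_values exp_sum_const CARD_bit
      power2_eq_square power4_eq_xxxx)

lemma kerdock_exp_sum_type:
  assumes x: "x \<in> kerdock" "x i = 0"
  obtains j where "j \<le> 3" "exp_sum_type j x"
  using x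
proof (cases rule: kerdock_word_types)
  case zero
  then show thesis using that[of 0] exp_sum_type_zero by simp
next
  case nonlinear
  then have "Re (exp_sum UNIV x) = sqrt_half_length \<or> Re (exp_sum UNIV x) = - sqrt_half_length"
    unfolding sqrt_half_length_square[symmetric] power2_eq_iff by blast
  then show thesis
  proof
    assume "Re (exp_sum UNIV x) = sqrt_half_length"
    with nonlinear(2,3) have "exp_sum_type 2 x"
      by (simp add: exp_sum_type_def exp_sum_values two_power_m_eq)
    then show thesis by (rule that[rotated]) simp
  next
    assume "Re (exp_sum UNIV x) = - sqrt_half_length"
    with nonlinear(2,3) have "exp_sum_type 1 x"
      by (simp add: exp_sum_type_def exp_sum_values two_power_m_eq)
    then show thesis by (rule that[rotated]) simp
  qed
next
  case linear
  then have "exp_sum_type 3 x"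
    by (simp add: exp_sum_type_def exp_sum_values two_power_m_eq)
  then show thesis by (rule that[rotated]) simp
qed

lemma weight_class_cases:
  assumes "x \<in> weight_class j" "j \<le> 3"
  obtains y where "y \<in> kerdock" "y i = 0" "x = restrict y I" "exp_sum_type j y"
proof -
  obtain y where y: "y \<in> kerdock" "y i = 0" "x = restrict y I"
    using assms(1) by (auto simp: weight_class_def elim: kshort_cases)
  obtain k where k: "k \<le> 3" "exp_sum_type k y" using kerdock_exp_sum_type[OF y(1,2)] .
  have "Re_value sqrt_half_length j = Re_value sqrt_half_length k"
    using assms weight_class_iff[OF y(1,2) assms(2)] k(2) by (simp add: y(3) exp_sum_type_def)
  then have "j = k" by (rule Re_value_inj[OF sqrt_half_length_ge_1 assms(2) k(1)])
  with y k that show thesis by blast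
qed

lemma weight_classI:
  "x \<in> kerdock \<Longrightarrow> x i = 0 \<Longrightarrow> j \<le> 3 \<Longrightarrow> exp_sum_type j x \<Longrightarrow> restrict x I \<in> weight_class j"
  by (simp add: weight_class_iff exp_sum_type_def)

lemma weight_class_cover: "(\<Union>j\<le>3. weight_class j) = kshort"
proof (intro equalityI subsetI)
  fix x assume "x \<in> kshort"
  then obtain y where y: "y \<in> kerdock" "y i = 0" "x = restrict y I" by (rule kshort_cases)
  obtain j where j: "j \<le> 3" "exp_sum_type j y" using kerdock_exp_sum_type[OF y(1,2)] .
  then have "x \<in> weight_class j" unfolding y(3) by (rule weight_classI[OF y(1,2)])
  with j(1) show "x \<in> (\<Union>j\<le>3. weight_class j)" by blast
qed (auto simp: weight_class_def)

lemma weight_class_disjoint: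
  assumes "j \<le> 3" "k \<le> 3" "j \<noteq> k"
  shows "weight_class j \<inter> weight_class k = {}"
proof (rule ccontr)
  assume "weight_class j \<inter> weight_class k \<noteq> {}"
  then obtain x where x: "x \<in> weight_class j" "x \<in> weight_class k" by blast
  obtain y where y: "y \<in> kerdock" "y i = 0" "x = restrict y I" "exp_sum_type j y"
    using weight_class_cases[OF x(1) assms(1)] .
  then have "Re_value sqrt_half_length j = Re_value sqrt_half_length k"
    using x(2) weight_class_iff[OF y(1,2) assms(2)] by (simp add: exp_sum_type_def)
  with assms Re_value_inj[OF sqrt_half_length_ge_1] show False by blast
qed

lemma weight_class_0: "weight_class 0 = {\<one>\<^bsub>A\<^esub>}"
proof (intro equalityI subsetI)
  fix x assume "x \<in> weight_class 0"
  then obtain y where "x = restrict y I" "exp_sum_type 0 y" by (rule weight_class_cases) simp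
  then show "x \<in> {\<one>\<^bsub>A\<^esub>}" by (simp add: exp_sum_type_def one_word_group)
next
  have "restrict (\<lambda>v. 0) I \<in> weight_class 0"
    using const_in_kerdock[of 0] exp_sum_type_zero by (intro weight_classI) simp_all
  then show "x \<in> weight_class 0" if "x \<in> {\<one>\<^bsub>A\<^esub>}" for x
    using that by (simp only: singleton_iff one_word_group)
qed

lemma weight_class_inv:
  assumes j: "j \<le> 3" and x: "x \<in> weight_class j"
  shows "inv\<^bsub>G\<^esub> x \<in> weight_class j"
proof -
  obtain y where y: "y \<in> kerdock" "y i = 0" "x = restrict y I"
    using weight_class_cases[OF x j] .
  have "inv\<^bsub>G\<^esub> x = inv\<^bsub>A\<^esub> x"
    unfolding y(3) using A.m_inv_consistent[OF subgroup_K restrict_in_kshort[OF y(1,2)]] .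
  also have "\<dots> = restrict (\<lambda>v. - y v) I"
    by (auto simp: y(3) inv_word_group fun_eq_iff)
  also have "\<dots> \<in> weight_class j"
    using x weight_class_iff[OF kerdock_uminus[OF y(1)] _ j] weight_class_iff[OF y(1,2) j]
    by (simp add: y(2,3) exp_sum_uminus)
  finally show ?thesis .
qed

lemma symmetric_partition_weight_class: "symmetric_partition G 3 weight_class"
  by (intro symmetric_partition.intro G.finite_comm_group_axioms symmetric_partition_axioms.intro)
    (simp_all add: weight_class_cover weight_class_disjoint weight_class_0 weight_class_inv)

lemma sum_coset_class_eq_Q_matrix:
  assumes j: "j \<le> 3" and k: "k \<le> 3" and x: "x \<in> weight_class j"
  shows "(\<Sum>Y\<in>coset_class k. i_power (coset_pairing I x Y)) =
    of_real (Q_matrix (4 * sqrt_half_length\<^sup>2) j k)"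
proof -
  obtain y where y: "y \<in> kerdock" "y i = 0" "x = restrict y I" and type: "exp_sum_type j y"
    using weight_class_cases[OF x j] .
  define W where "W = exp_sum UNIV y"
  have W: "W + cnj W = of_real (2 * Re_value sqrt_half_length j)"
      "W * cnj W = of_real (norm_value sqrt_half_length j)"
    and twice: "exp_sum UNIV (\<lambda>v. 2 * y v) = of_real (twice_value sqrt_half_length j)"
    using type complex_add_cnj[of W] by (simp_all add: exp_sum_type_def W_def)
  have "(W - 1) + cnj (W - 1) = of_real (2 * (Re_value sqrt_half_length j - 1))"
    using W(1) by simp
  moreover have "(W - 1) * cnj (W - 1) - of_nat (card I) =
      W * cnj W - (W + cnj W) + 2 - 2 ^ CARD('m)"
    by (simp add: card_I of_nat_diff algebra_simps)
  then have "(W - 1) * cnj (W - 1) - of_nat (card I) =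
      of_real (norm_value sqrt_half_length j - 2 * Re_value sqrt_half_length j + 2 -
        2 * sqrt_half_length\<^sup>2)"
    unfolding W two_power_m_eq by simp
  moreover have "exp_sum I y = W - 1"
      "exp_sum I (\<lambda>v. 2 * y v) = of_real (twice_value sqrt_half_length j - 1)"
    using exp_sum_I[of y] exp_sum_I[of "\<lambda>v. 2 * y v"] y(2) twice by (simp_all add: W_def)
  ultimately show ?thesis
    unfolding y(3) sum_coset_class_eq_sum_pair_class[OF y(1,2) k]
      sum_pair_class[where x = y, OF y(2) k]
    using sqrt_half_length_ge_1 j by (cases rule: le_3_cases[OF k]) (simp_all add: Q_matrix_eq)
qed

end

locale kerdock_scheme = shortened_kerdock S i
  for S :: "'m::{finite,linorder} bmat set" and i :: "'m bvec" +
  assumes m_ge_3: "CARD('m) \<ge> 3"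
begin

sublocale scheme: dual_partitions G H "\<lambda>x Y. i_power (coset_pairing I x Y)" 3
  weight_class coset_class "P_matrix (4 * sqrt_half_length\<^sup>2)" "Q_matrix (4 * sqrt_half_length\<^sup>2)"
proof (intro dual_partitions.intro dual_partitions_axioms.intro bicharacter_axioms
    symmetric_partition_weight_class symmetric_partition_coset_class)
  have "real (card (carrier G)) = (2 ^ CARD('m))\<^sup>2"
    by (simp add: card_kshort power2_eq_square flip: power_mult_distrib)
  also have "\<dots> = 4 * sqrt_half_length ^ 4"
    by (simp add: power_mult_distrib flip: twice_sqrt_half_length_square)
  finally show "(\<Sum>l\<le>3. Q_matrix (4 * sqrt_half_length\<^sup>2) j l *
        P_matrix (4 * sqrt_half_length\<^sup>2) l k) =
      (if j = k then real (card (carrier G)) else 0)" if "j \<le> 3" "k \<le> 3" for j k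
    using that sqrt_half_length_ge_1 by (simp add: Q_matrix_mult_P_matrix)
  show "coset_class j \<noteq> {}" if "j \<le> 3" for j
    using that pair_class_nonempty[OF m_ge_3] by (simp add: coset_class_eq)
qed (rule sum_coset_class_eq_Q_matrix)

sublocale dual: dual_partitions H G "\<lambda>Y x. i_power (coset_pairing I x Y)" 3
  coset_class weight_class "Q_matrix (4 * sqrt_half_length\<^sup>2)" "P_matrix (4 * sqrt_half_length\<^sup>2)"
  by (rule scheme.dual_partitions_flip)

end

theorem theorem1:
  fixes K Prep Kshort C :: "('m::{finite,linorder} bvec \<Rightarrow> 4) set"
    and i :: "'m bvec" and I :: "'m bvec set"
    and m q :: nat and N :: real
    and A G :: "('m bvec \<Rightarrow> 4) monoid"
    and e :: "'m bvec \<Rightarrow> 'm bvec \<Rightarrow> 4"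
    and R :: "nat \<Rightarrow> (('m bvec \<Rightarrow> 4) \<times> ('m bvec \<Rightarrow> 4)) set"
    and R' :: "nat \<Rightarrow> (('m bvec \<Rightarrow> 4) set \<times> ('m bvec \<Rightarrow> 4) set) set"
  assumes m: "m = CARD('m)" "m \<ge> 3" "odd m"
    and q: "q = 2 ^ m" and N: "N = 2 * real q"
    and kerdock: "kerdock_code K"
    and linear: "subgroup K (word_group UNIV)"
    and Prep: "Prep = dual_code UNIV K"
    and I: "I = UNIV - {i}"
    and Kshort: "Kshort = shorten UNIV i K"
    and C: "C = puncture UNIV i Prep"
    and A: "A = word_group I"
    and G: "G = A\<lparr>carrier := Kshort\<rparr>"
    and R: "R = (\<lambda>j. diff_rel G {x. lee_weight I x =
              [0, 2 ^ m + 2 ^ ((m - 1) div 2), 2 ^ m - 2 ^ ((m - 1) div 2), 2 ^ m] ! j})"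
    and e: "e = unit_word I"
    and R': "R' = (\<lambda>j. diff_rel (A Mod C)
              ([{C},
                {C #>\<^bsub>A\<^esub> e k | k. k \<in> I} \<union> {C #>\<^bsub>A\<^esub> inv\<^bsub>A\<^esub> e k | k. k \<in> I},
                {C #>\<^bsub>A\<^esub> (e k \<otimes>\<^bsub>A\<^esub> inv\<^bsub>A\<^esub> e l) | k l. k \<in> I \<and> l \<in> I \<and> k \<noteq> l},
                {C #>\<^bsub>A\<^esub> (e k \<otimes>\<^bsub>A\<^esub> e k) | k. k \<in> I}] ! j))"
  shows "dual_code I Kshort = C \<and> card Kshort = 4 ^ m \<and> card (carrier (A Mod C)) = 4 ^ m \<and>
    abelian_scheme G 3 R \<and>
    abelian_scheme (A Mod C) 3 R' \<and>
    (\<forall>x\<in>Kshort. \<forall>Y\<in>carrier (A Mod C). \<forall>y\<in>Y. coset_pairing I x Y = dot_product I x y) \<and>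
    (\<exists>E E'.
      idempotent_ordering Kshort 3 R E \<and>
      first_eigenmatrix 3 R E (P_matrix N) \<and>
      second_eigenmatrix Kshort 3 R E (Q_matrix N) \<and>
      dual_scheme_via G E (A Mod C) 3 R' (coset_pairing I) \<and>
      idempotent_ordering (carrier (A Mod C)) 3 R' E' \<and>
      first_eigenmatrix 3 R' E' (Q_matrix N) \<and>
      second_eigenmatrix (carrier (A Mod C)) 3 R' E' (P_matrix N))"
proof -
  obtain S where S: "kerdock_set S" "K = kerdock_words S"
    using kerdock by (auto simp: kerdock_code_def)
  interpret code: kerdock_scheme S i
    using S linear m
    by (intro kerdock_scheme.intro shortened_kerdock.intro linear_kerdock.intro
        kerdock_scheme_axioms.intro) simp_all
  have N_eq: "N = 4 * code.sqrt_half_length\<^sup>2"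
    using code.twice_sqrt_half_length_square by (simp add: N q m(1))
  have Kshort_eq: "Kshort = code.kshort" and A_eq: "A = code.A" and C_eq: "C = code.C"
    by (simp_all add: Kshort A I C Prep S(2) code.dual_code_kshort)
  have G_eq: "G = code.G" and carrier_G: "carrier code.G = code.kshort"
    by (simp_all add: G A_eq Kshort_eq)
  have R_eq: "R = code.scheme.G.Rel"
    by (simp add: fun_eq_iff R G_eq I m(1) code.scheme.G.Rel_def code.weight_class_def
        code.G.diff_rel_Collect_carrier)
  have R'_eq: "R' = code.scheme.H.Rel"
    by (simp add: fun_eq_iff R' A_eq C_eq e I code.scheme.H.Rel_def code.coset_class_def)
  show ?thesis
    unfolding N_eq R_eq R'_eq G_eq A_eq C_eq Kshort_eq I m(1)
    by (intro conjI ballI exI[of _ code.scheme.idem] exI[of _ code.dual.idem] refl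
        code.card_kshort code.card_H code.coset_pairing_well_defined
        code.scheme.abelian_scheme_Rel code.dual.abelian_scheme_Rel
        code.scheme.idempotent_ordering_idem[unfolded carrier_G]
        code.scheme.first_eigenmatrix_P code.scheme.second_eigenmatrix_Q[unfolded carrier_G]
        code.scheme.dual_scheme_viaI[OF code.nondegenerate_coset_pairing code.right_character_eq]
        code.dual.idempotent_ordering_idem code.dual.first_eigenmatrix_P
        code.dual.second_eigenmatrix_Q)
qed

end
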